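(* Let $(\alpha,\beta)\in\mathbb{K}^2\setminus\{(0,0)\}$. The Poisson prime ideal $\langle\Omega_1-\alpha,\Omega_2-\beta\rangle$ is a maximal Poisson ideal of $\mathcal{A}$ (i.e. maximal among the proper Poisson ideals of $\mathcal{A}$).
   Context: $\mathbb{K}$ is a field of characteristic zero. $\mathcal{A}=\mathbb{K}[X_1,\ldots,X_6]$ is the polynomial algebra with the Poisson bracket $\{X_2,X_1\}=-3X_1X_2$, $\{X_3,X_1\}=-X_1X_3-X_2$, $\{X_3,X_2\}=-3X_2X_3$, $\{X_4,X_1\}=-2X_3^2$, $\{X_4,X_2\}=-3X_2X_4-4X_3^3$, $\{X_4,X_3\}=-3X_3X_4$, $\{X_5,X_1\}=X_1X_5-2X_3$, $\{X_5,X_2\}=-6X_3^2$, $\{X_5,X_3\}=-X_3X_5-3X_4$, $\{X_5,X_4\}=-3X_4X_5$, $\{X_6,X_1\}=3X_1X_6-3X_5$, $\{X_6,X_2\}=3X_2X_6+9X_4-18X_3X_5$, $\{X_6,X_3\}=-6X_5^2$, $\{X_6,X_4\}=-3X_4X_6-4X_5^3$, $\{X_6,X_5\}=-3X_5X_6$. $\Omega_1=X_1X_3X_5-\frac32X_1X_4-\frac12X_2X_5+\frac12X_3^2$ and $\Omega_2=X_2X_4X_6-\frac23X_3^3X_6-\frac23X_2X_5^3+2X_3^2X_5^2-3X_3X_4X_5+\frac32X_4^2$ (both Poisson central). $\langle\cdot\rangle$ denotes the ideal of $\mathcal{A}$ generated by the listed elements. A Poisson ideal is an ideal $I$ with $\{\mathcal{A},I\}\subseteq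 I$; a Poisson prime ideal of $\mathcal{A}$ is a Poisson ideal that is also a prime ideal. *)

theory Defs
  imports
    "HOL-Library.Poly_Mapping"
    "HOL-Library.Numeral_Type"
    "HOL-Algebra.Algebraic_Closure_Type"
begin

text \<open>
  Polynomials in six variables: exponent vectors are finitely supported functions
  \<open>6 \<Rightarrow>\<^sub>0 nat\<close> on the six-element numeral type, and polynomials are finitely supported
  functions on exponent vectors with the convolution product. In the type \<open>6\<close> the numerals
  \<open>1, \<dots>, 6\<close> denote the six distinct elements (and \<open>6 = 0\<close>).
\<close>

type_synonym 'a poly6 = "(6 \<Rightarrow>\<^sub>0 nat) \<Rightarrow>\<^sub>0 'a"

definition Const :: "'a::field_char_0 \<Rightarrow> 'a poly6" where
  "Const c = Poly_Mapping.single 0 c"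

definition Var :: "6 \<Rightarrow> 'a::field_char_0 poly6" where
  "Var i = Poly_Mapping.single (Poly_Mapping.single i 1) 1"

text \<open>
  The partial derivative. The subtraction on exponents is truncated, which is harmless:
  where \<open>i\<close> does not occur in \<open>m\<close> the coefficient vanishes.
\<close>

definition pdiff :: "6 \<Rightarrow> 'a::field_char_0 poly6 \<Rightarrow> 'a poly6" where
  "pdiff i p = (\<Sum>m\<in>Poly_Mapping.keys p. Poly_Mapping.single (m - Poly_Mapping.single i 1)
                              (of_nat (Poly_Mapping.lookup m i) * Poly_Mapping.lookup p m))"

definition jac :: "6 \<Rightarrow> 6 \<Rightarrow> 'a::field_char_0 poly6 \<Rightarrow> 'a poly6 \<Rightarrow> 'a poly6" where
  "jac i j f g = pdiff i f * pdiff j g - pdiff j f * pdiff i g"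

text \<open>
  A Poisson bracket on a polynomial algebra is a biderivation, so it is determined by its values
  on the variables through
  \<open>{f, g} = (\<Sum>i>j. {X\<^sub>i, X\<^sub>j} (\<partial>\<^sub>i f \<partial>\<^sub>j g - \<partial>\<^sub>j f \<partial>\<^sub>i g))\<close>.
\<close>

definition pbracket :: "'a::field_char_0 poly6 \<Rightarrow> 'a poly6 \<Rightarrow> 'a poly6" where
  "pbracket f g =
     (- 3 * Var 1 * Var 2) * jac 2 1 f g
   + (- Var 1 * Var 3 - Var 2) * jac 3 1 f g
   + (- 3 * Var 2 * Var 3) * jac 3 2 f g
   + (- 2 * Var 3 ^ 2) * jac 4 1 f g
   + (- 3 * Var 2 * Var 4 - 4 * Var 3 ^ 3) * jac 4 2 f g
   + (- 3 * Var 3 * Var 4) * jac 4 3 f g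
   + (Var 1 * Var 5 - 2 * Var 3) * jac 5 1 f g
   + (- 6 * Var 3 ^ 2) * jac 5 2 f g
   + (- Var 3 * Var 5 - 3 * Var 4) * jac 5 3 f g
   + (- 3 * Var 4 * Var 5) * jac 5 4 f g
   + (3 * Var 1 * Var 6 - 3 * Var 5) * jac 6 1 f g
   + (3 * Var 2 * Var 6 + 9 * Var 4 - 18 * Var 3 * Var 5) * jac 6 2 f g
   + (- 6 * Var 5 ^ 2) * jac 6 3 f g
   + (- 3 * Var 4 * Var 6 - 4 * Var 5 ^ 3) * jac 6 4 f g
   + (- 3 * Var 5 * Var 6) * jac 6 5 f g"

definition Omega1 :: "'a::field_char_0 poly6" where
  "Omega1 = Var 1 * Var 3 * Var 5 - Const (3/2) * Var 1 * Var 4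
          - Const (1/2) * Var 2 * Var 5 + Const (1/2) * Var 3 ^ 2"

definition Omega2 :: "'a::field_char_0 poly6" where
  "Omega2 = Var 2 * Var 4 * Var 6 - Const (2/3) * Var 3 ^ 3 * Var 6
          - Const (2/3) * Var 2 * Var 5 ^ 3 + 2 * Var 3 ^ 2 * Var 5 ^ 2
          - 3 * Var 3 * Var 4 * Var 5 + Const (3/2) * Var 4 ^ 2"

abbreviation poly6_ring :: "'a::field_char_0 poly6 ring" where
  "poly6_ring \<equiv> ring_of_type_algebra"

definition poisson_ideal :: "'a::field_char_0 poly6 set \<Rightarrow> bool" where
  "poisson_ideal I \<longleftrightarrow> ideal I poly6_ring \<and> (\<forall>f. \<forall>g\<in>I. pbracket f g \<in> I)"

definition poisson_prime_ideal :: "'a::field_char_0 poly6 set \<Rightarrow> bool" where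
  "poisson_prime_ideal I \<longleftrightarrow> poisson_ideal I \<and> primeideal I poly6_ring"

definition maximal_poisson_ideal :: "'a::field_char_0 poly6 set \<Rightarrow> bool" where
  "maximal_poisson_ideal I \<longleftrightarrow>
     poisson_ideal I \<and> I \<noteq> UNIV \<and>
     (\<forall>J. poisson_ideal J \<and> J \<noteq> UNIV \<and> I \<subseteq> J \<longrightarrow> J = I)"


lemma pdiff_superset:
  assumes "finite A" "Poly_Mapping.keys p \<subseteq> A"
  shows "pdiff i p = (\<Sum>m\<in>A. Poly_Mapping.single (m - Poly_Mapping.single i 1)
                              (of_nat (Poly_Mapping.lookup m i) * Poly_Mapping.lookup p m))"
  unfolding pdiff_def
  by (rule sum.mono_neutral_left) (use assms in \<open>auto simp: in_keys_iff\<close>)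

lemma pdiff_single:
  "pdiff i (Poly_Mapping.single m c)
     = Poly_Mapping.single (m - Poly_Mapping.single i 1) (of_nat (Poly_Mapping.lookup m i) * c)"
  by (subst pdiff_superset[of "{m}"]) auto

lemma pdiff_add: "pdiff i (p + q) = pdiff i p + pdiff i q"
proof -
  let ?A = "Poly_Mapping.keys p \<union> Poly_Mapping.keys q"
  have "Poly_Mapping.keys (p + q) \<subseteq> ?A" by (rule Poly_Mapping.keys_add)
  then show ?thesis
    by (simp add: pdiff_superset[of ?A] lookup_add distrib_left single_add sum.distrib)
qed

lemma pdiff_0 [simp]: "pdiff i 0 = 0"
  by (simp add: pdiff_def)

lemma pdiff_Const [simp]: "pdiff i (Const c) = 0"
  by (simp add: Const_def pdiff_single)

lemma pdiff_Var: "pdiff i (Var j) = (if i = j then 1 else 0)"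
  by (auto simp: Var_def pdiff_single lookup_single when_def)

lemma pdiff_mult_single:
  fixes a b :: "'a::field_char_0"
  shows "pdiff i (Poly_Mapping.single m a * Poly_Mapping.single n b)
   = pdiff i (Poly_Mapping.single m a) * Poly_Mapping.single n b
   + Poly_Mapping.single m a * pdiff i (Poly_Mapping.single n b)"
proof -
  let ?e = "Poly_Mapping.single i (1::nat)"
  have cancel: "m' - ?e + n' = m' + n' - ?e" if "Poly_Mapping.lookup m' i \<noteq> 0" for m' n' :: "6 \<Rightarrow>\<^sub>0 nat"
    by (rule poly_mapping_eqI)
       (use that in \<open>auto simp: lookup_add lookup_minus lookup_single when_def\<close>)
  have 1: "Poly_Mapping.single (m - ?e) (of_nat (Poly_Mapping.lookup m i) * a) * Poly_Mapping.single n b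
      = Poly_Mapping.single (m + n - ?e) (of_nat (Poly_Mapping.lookup m i) * a * b)"
    using cancel[of m n] by (cases "Poly_Mapping.lookup m i = 0") (auto simp: mult_single)
  have 2: "Poly_Mapping.single m a * Poly_Mapping.single (n - ?e) (of_nat (Poly_Mapping.lookup n i) * b)
      = Poly_Mapping.single (m + n - ?e) (of_nat (Poly_Mapping.lookup n i) * a * b)"
    using cancel[of n m]
    by (cases "Poly_Mapping.lookup n i = 0") (auto simp: mult_single add.commute mult_ac)
  show ?thesis
    unfolding pdiff_single 1 2 unfolding mult_single pdiff_single
    by (simp add: lookup_add distrib_right mult.assoc flip: single_add)
qed

lemma poly6_induct [case_names single sum]:
  assumes "\<And>m c. Q (Poly_Mapping.single m c)"
    and "\<And>p q. Q p \<Longrightarrow> Q q \<Longrightarrow> Q (p + q)"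
  shows "Q (p :: 'a::field_char_0 poly6)"
proof (induction p rule: Poly_Mapping.update_induct)
  case const
  show ?case using assms(1)[of 0 0] by simp
next
  case (update p m c)
  then have "Poly_Mapping.update m c p = Poly_Mapping.single m c + p"
    by (intro poly_mapping_eqI)
       (auto simp: lookup_update lookup_add lookup_single when_def in_keys_iff)
  with update assms show ?case by metis
qed

lemma pdiff_mult: "pdiff i (p * q) = pdiff i p * q + p * pdiff i q"
proof -
  have *: "pdiff i (Poly_Mapping.single m c * q)
      = pdiff i (Poly_Mapping.single m c) * q + Poly_Mapping.single m c * pdiff i q" for m c
  proof (induction q rule: poly6_induct)
    case (single n b)
    then show ?case by (rule pdiff_mult_single)
  next
    case (sum f g)
    then show ?case by (simp add: pdiff_add algebra_simps)
  qed
  show ?thesis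
  proof (induction p rule: poly6_induct)
    case (single n b)
    then show ?case by (rule *)
  next
    case (sum f g)
    then show ?case by (simp add: pdiff_add algebra_simps)
  qed
qed

lemma pbracket_skew: "pbracket g f = - pbracket f g"
  by (simp add: pbracket_def jac_def algebra_simps)

lemma pbracket_add_right: "pbracket f (g + h) = pbracket f g + pbracket f h"
  by (simp add: pbracket_def jac_def pdiff_add algebra_simps)

lemma pbracket_mult_right: "pbracket f (g * h) = pbracket f g * h + g * pbracket f h"
proof -
  have *: "jac i j f (g * h) = jac i j f g * h + g * jac i j f h" for i j
    by (simp add: jac_def pdiff_mult algebra_simps)
  show ?thesis
    unfolding pbracket_def * by (simp only: distrib_left distrib_right ac_simps)
qed

lemma pbracket_Const_right [simp]: "pbracket f (Const c) = 0"
  by (simp add: pbracket_def jac_def)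

lemma pbracket_Var:
  "pbracket (Var 2) (Var 1) = - 3 * Var 1 * Var 2"
  "pbracket (Var 3) (Var 1) = - Var 1 * Var 3 - Var 2"
  "pbracket (Var 3) (Var 2) = - 3 * Var 2 * Var 3"
  "pbracket (Var 4) (Var 1) = - 2 * Var 3 ^ 2"
  "pbracket (Var 4) (Var 2) = - 3 * Var 2 * Var 4 - 4 * Var 3 ^ 3"
  "pbracket (Var 4) (Var 3) = - 3 * Var 3 * Var 4"
  "pbracket (Var 5) (Var 1) = Var 1 * Var 5 - 2 * Var 3"
  "pbracket (Var 5) (Var 2) = - 6 * Var 3 ^ 2"
  "pbracket (Var 5) (Var 3) = - Var 3 * Var 5 - 3 * Var 4"
  "pbracket (Var 5) (Var 4) = - 3 * Var 4 * Var 5"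
  "pbracket (Var 6) (Var 1) = 3 * Var 1 * Var 6 - 3 * Var 5"
  "pbracket (Var 6) (Var 2) = 3 * Var 2 * Var 6 + 9 * Var 4 - 18 * Var 3 * Var 5"
  "pbracket (Var 6) (Var 3) = - 6 * Var 5 ^ 2"
  "pbracket (Var 6) (Var 4) = - 3 * Var 4 * Var 6 - 4 * Var 5 ^ 3"
  "pbracket (Var 6) (Var 5) = - 3 * Var 5 * Var 6"
  by (simp_all add: pbracket_def jac_def pdiff_Var)

end

theory Submission
  imports Defs
begin

text \<open>
  The proof is geometric. Up to the factors \<open>2\<close> and \<open>6\<close>, \<open>\<Omega>\<^sub>1\<close> is linear in \<open>X\<^sub>1\<close> with coefficient
  \<open>slope1\<close> and \<open>\<Omega>\<^sub>2\<close> is linear in \<open>X\<^sub>6\<close> with coefficient \<open>slope2\<close>, where both coefficients lie in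
  \<open>C = K[X\<^sub>2, \<dots>, X\<^sub>5]\<close>. Write \<open>P\<close> for the ideal of the common level set and \<open>w\<close> for the product of the
  two coefficients. Outside \<open>w = 0\<close> the level set is the graph of a function of \<open>X\<^sub>2, \<dots>, X\<^sub>5\<close>, and
  \<open>C\<close> is closed under the bracket, with a \<open>4 \<times> 4\<close> bracket matrix whose Pfaffian is \<open>w / 2\<close>. So the
  level set is symplectic there, and \<open>w \<partial>\<^sub>i g\<close> is a combination of brackets of \<open>g\<close> for every
  \<open>g \<in> C\<close>. Three facts follow.

  (1) \<^emph>\<open>A Poisson ideal \<open>J \<supseteq> P\<close> that does not vanish on the graph contains a power of \<open>w\<close>.\<close> After
  multiplication by a power of \<open>w\<close> and reduction modulo \<open>P\<close>, \<open>J\<close> contains a nonzero element of \<open>C\<close>; since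
  the saturation of \<open>J\<close> by \<open>w\<close> is closed under the partial derivatives of elements of \<open>C\<close>,
  differentiating down to a constant puts \<open>1\<close> into it (\<open>slopes_power_in_poisson_ideal\<close>).

  (2) \<^emph>\<open>A Poisson ideal \<open>J \<supseteq> P\<close> that contains a power of \<open>w\<close> contains \<open>1\<close>.\<close> The radical of \<open>J\<close> is again
  a Poisson ideal, and brackets of \<open>w\<close> with \<open>X\<^sub>1\<close> and \<open>X\<^sub>6\<close> lead to \<open>\<Omega>\<^sub>1\<close> in the radical if \<open>\<alpha> \<noteq> 0\<close>, and to
  \<open>\<Omega>\<^sub>2\<close> in the radical if \<open>\<beta> \<noteq> 0\<close>. But \<open>\<Omega>\<^sub>1 = \<alpha>\<close> and \<open>\<Omega>\<^sub>2 = \<beta>\<close> modulo \<open>P\<close>, so the radical contains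
  a nonzero constant. Geometrically, no symplectic leaf of the level set lies inside \<open>w = 0\<close>
  (\<open>degeneracy_locus_empty\<close>).

  (3) \<^emph>\<open>\<open>P\<close> is the kernel \<open>T\<close> of the substitution of the graph into polynomials, hence prime.\<close>
  Reduction modulo \<open>P\<close> shows that \<open>T\<close> is the saturation of \<open>P\<close> by \<open>w\<close>, so \<open>T\<close> is a Poisson ideal and each of its elements is carried
  into \<open>P\<close> by some power of \<open>w\<close>. Because \<open>T\<close> is finitely generated (\<open>hilbert_basis\<close>), one power works for
  all of \<open>T\<close>. Thus the Poisson ideal \<open>{c. c T \<subseteq> P}\<close> contains \<open>P\<close> and a power of \<open>w\<close>, and (2) puts \<open>1\<close>
  into it, that is, \<open>T = P\<close> (\<open>kernel_eq_level_ideal\<close>).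

  Maximality combines the three facts: by (3) a Poisson ideal strictly above \<open>P\<close> does not vanish on the
  graph, and (1) and (2) then put \<open>1\<close> into it.
\<close>

section \<open>Ideals of a commutative ring type\<close>

lemma ideal_of_type_iff:
  "ideal I (ring_of_type_algebra :: 'a::comm_ring_1 ring) \<longleftrightarrow>
     0 \<in> I \<and> (\<forall>a\<in>I. \<forall>b\<in>I. a + b \<in> I) \<and> (\<forall>a\<in>I. \<forall>c. c * a \<in> I)"
proof
  let ?R = "ring_of_type_algebra :: 'a ring"
  assume "ideal I ?R"
  then interpret ideal I ?R .
  show "0 \<in> I \<and> (\<forall>a\<in>I. \<forall>b\<in>I. a + b \<in> I) \<and> (\<forall>a\<in>I. \<forall>c. c * a \<in> I)"
    using additive_subgroup.zero_closed[OF is_additive_subgroup]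
      additive_subgroup.a_closed[OF is_additive_subgroup] I_l_closed
    by (simp add: ring_of_type_algebra_def)
next
  let ?R = "ring_of_type_algebra :: 'a ring"
  assume I: "0 \<in> I \<and> (\<forall>a\<in>I. \<forall>b\<in>I. a + b \<in> I) \<and> (\<forall>a\<in>I. \<forall>c. c * a \<in> I)"
  have R: "ring ?R" by (rule ring_from_type_algebra)
  then interpret ring ?R .
  have "subgroup I (add_monoid ?R)"
  proof (rule add.subgroupI)
    fix a assume a: "a \<in> I"
    have "\<ominus>\<^bsub>?R\<^esub> a = - 1 * a"
      by (rule minus_equality) (auto simp: ring_of_type_algebra_def)
    with I a show "\<ominus>\<^bsub>?R\<^esub> a \<in> I" by metis
  qed (use I in \<open>auto simp: ring_of_type_algebra_def\<close>)
  then show "ideal I ?R"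
    by (intro idealI R) (use I in \<open>auto simp: ring_of_type_algebra_def mult.commute\<close>)
qed

abbreviation is_ideal :: "'a::comm_ring_1 set \<Rightarrow> bool" where
  "is_ideal I \<equiv> ideal I ring_of_type_algebra"

lemma is_ideal_zero: "is_ideal I \<Longrightarrow> 0 \<in> I"
  and is_ideal_add: "is_ideal I \<Longrightarrow> a \<in> I \<Longrightarrow> b \<in> I \<Longrightarrow> a + b \<in> I"
  and is_ideal_mult_left: "is_ideal I \<Longrightarrow> a \<in> I \<Longrightarrow> c * a \<in> I"
  and is_ideal_mult_right: "is_ideal I \<Longrightarrow> a \<in> I \<Longrightarrow> a * c \<in> I"
  by (simp_all add: ideal_of_type_iff mult.commute)

lemma is_ideal_uminus: "is_ideal I \<Longrightarrow> a \<in> I \<Longrightarrow> - a \<in> I"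
  using is_ideal_mult_left[of I a "- 1"] by simp

lemma is_ideal_diff: "is_ideal I \<Longrightarrow> a \<in> I \<Longrightarrow> b \<in> I \<Longrightarrow> a - b \<in> I"
  using is_ideal_add[of I a "- b"] is_ideal_uminus[of I b] by simp

lemmas is_ideal_closed =
  is_ideal_zero is_ideal_add is_ideal_mult_left is_ideal_mult_right is_ideal_uminus is_ideal_diff

section \<open>The Hilbert basis theorem\<close>

lemma monotone_subsequence_nat:
  fixes s :: "nat \<Rightarrow> nat"
  shows "\<exists>r :: nat \<Rightarrow> nat. strict_mono r \<and> mono (\<lambda>n. s (r n))"
proof -
  obtain q :: "nat \<Rightarrow> nat" where q: "strict_mono q" "monoseq (\<lambda>n. s (q n))"
    using seq_monosub by blast
  show ?thesis
  proof (cases "incseq (\<lambda>n. s (q n))")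
    case True
    then have "mono (\<lambda>n. s (q n))" by (simp add: incseq_def mono_def)
    with q(1) show ?thesis by (intro exI[of _ q]) simp
  next
    case False
    with q(2) have dec: "decseq (\<lambda>n. s (q n))" by (simp add: monoseq_iff)
    obtain N where N: "\<And>n. s (q N) \<le> s (q n)"
      using ex_has_least_nat[of "\<lambda>_. True" 0 "\<lambda>n. s (q n)"] by auto
    have "s (q (N + n)) = s (q N)" for n
      using N[of "N + n"] decseqD[OF dec, of N "N + n"] by simp
    moreover have "strict_mono (\<lambda>n. q (N + n))"
      using q(1) by (simp add: strict_mono_def)
    ultimately show ?thesis
      by (intro exI[of _ "\<lambda>n. q (N + n)"]) (simp add: mono_def)
  qed
qed

lemma monotone_subsequence_vector:
  fixes x :: "nat \<Rightarrow> 'i::finite \<Rightarrow> nat"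
  shows "\<exists>r :: nat \<Rightarrow> nat. strict_mono r \<and> (\<forall>i. mono (\<lambda>n. x (r n) i))"
proof -
  have "\<exists>r :: nat \<Rightarrow> nat. strict_mono r \<and> (\<forall>i\<in>A. mono (\<lambda>n. x (r n) i))" if "finite A" for A
    using that
  proof (induction A rule: finite_induct)
    case empty
    show ?case by (intro exI[of _ "\<lambda>n. n"]) (simp add: strict_mono_def)
  next
    case (insert a A)
    then obtain r :: "nat \<Rightarrow> nat" where r: "strict_mono r" "\<And>i. i \<in> A \<Longrightarrow> mono (\<lambda>n. x (r n) i)" by blast
    obtain q :: "nat \<Rightarrow> nat" where q: "strict_mono q" "mono (\<lambda>n. x (r (q n)) a)"
      using monotone_subsequence_nat[of "\<lambda>n. x (r n) a"] by blast
    have "mono (\<lambda>n. x (r (q n)) i)" if "i \<in> A" for i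
      using r(2)[OF that] strict_mono_mono[OF q(1)] by (auto simp: mono_def)
    moreover have "strict_mono (r \<circ> q)" using r(1) q(1) by (rule strict_mono_o)
    ultimately show ?case using q(2) by (intro exI[of _ "r \<circ> q"]) (simp add: comp_def)
  qed
  from this[of UNIV] show ?thesis by simp
qed

lemma lookup_le_imp_add:
  fixes x y :: "'i \<Rightarrow>\<^sub>0 nat"
  assumes "\<And>i. Poly_Mapping.lookup y i \<le> Poly_Mapping.lookup x i"
  shows "x = y + (x - y)"
  by (rule poly_mapping_eqI) (simp add: lookup_add lookup_minus assms)

lemma infinite_dominated_pair:
  fixes x :: "nat \<Rightarrow> ('i::finite \<Rightarrow>\<^sub>0 nat)"
  shows "\<exists>i j z. i < j \<and> x j = x i + z"
proof -
  obtain r :: "nat \<Rightarrow> nat" where r: "strict_mono r" "\<And>i. mono (\<lambda>n. Poly_Mapping.lookup (x (r n)) i)"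
    using monotone_subsequence_vector[of "\<lambda>n. Poly_Mapping.lookup (x n)"] by blast
  have "x (r 1) = x (r 0) + (x (r 1) - x (r 0))"
    by (rule lookup_le_imp_add) (use r(2) in \<open>auto simp: mono_def\<close>)
  moreover have "r 0 < r 1" using r(1) by (simp add: strict_mono_def)
  ultimately show ?thesis by blast
qed

text \<open>
  Dickson's lemma: the finite set consists of the minimal elements. An infinite set of minimal
  elements would contain two distinct comparable ones.
\<close>

lemma dickson:
  fixes S :: "('i::finite \<Rightarrow>\<^sub>0 nat) set"
  shows "\<exists>F. finite F \<and> F \<subseteq> S \<and> (\<forall>x\<in>S. \<exists>y\<in>F. \<exists>z. x = y + z)"
proof -
  let ?deg = "\<lambda>x :: 'i \<Rightarrow>\<^sub>0 nat. \<Sum>i\<in>UNIV. Poly_Mapping.lookup x i"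
  define F where "F = {y \<in> S. \<forall>x\<in>S. \<forall>z. y = x + z \<longrightarrow> y = x}"
  have "finite F"
  proof (rule ccontr)
    assume "infinite F"
    then obtain f :: "nat \<Rightarrow> _" where f: "inj f" "range f \<subseteq> F"
      using infinite_countable_subset by blast
    obtain i j z where "i < j" "f j = f i + z"
      using infinite_dominated_pair[of f] by blast
    moreover have "f i \<in> S" "f j \<in> F" using f(2) by (auto simp: F_def)
    ultimately have "f j = f i" unfolding F_def by blast
    with f(1) \<open>i < j\<close> show False by (simp add: inj_eq)
  qed
  moreover have "\<exists>y\<in>F. \<exists>z. x = y + z" if "x \<in> S" for x
  proof -
    have "x \<in> S \<and> (\<exists>z. x = x + z)" using that by (metis add.right_neutral)
    from ex_has_least_nat[of "\<lambda>y. y \<in> S \<and> (\<exists>z. x = y + z)" x ?deg, OF this]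
    obtain y where y: "y \<in> S" "\<exists>z. x = y + z"
      and min: "\<And>y'. y' \<in> S \<and> (\<exists>z. x = y' + z) \<Longrightarrow> ?deg y \<le> ?deg y'" by blast
    have "y = y'" if "y' \<in> S" "y = y' + z" for y' z
    proof -
      have "?deg y \<le> ?deg y'" using min[of y'] y(2) that by (auto simp: add.assoc)
      then have "?deg z = 0" using that(2) by (simp add: lookup_add sum.distrib)
      then have "z = 0" by (intro poly_mapping_eqI) simp
      with that show ?thesis by simp
    qed
    with y show ?thesis by (auto simp: F_def)
  qed
  ultimately show ?thesis by (intro exI[of _ F]) (auto simp: F_def)
qed

lemma le_add_exponent:
  fixes x z :: "'i::linorder \<Rightarrow>\<^sub>0 nat"
  shows "x \<le> x + z"
proof -
  have "\<not> z < 0" by (auto simp: less_poly_mapping.rep_eq less_fun_def)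
  then have "x + 0 \<le> x + z" by (intro add_left_mono) simp
  then show ?thesis by simp
qed

text \<open>
  A descending sequence of exponent vectors would contain a pair \<open>x\<^sub>i, x\<^sub>j = x\<^sub>i + z\<close> with \<open>i < j\<close> by
  Dickson's argument, but the lexicographic order extends the componentwise order.
\<close>

lemma wf_exponent_less: "wf {(a, b :: 'i::{finite,linorder} \<Rightarrow>\<^sub>0 nat). a < b}"
  unfolding wf_iff_no_infinite_down_chain
proof
  assume "\<exists>f. \<forall>i. (f (Suc i), f i) \<in> {(a, b :: 'i \<Rightarrow>\<^sub>0 nat). a < b}"
  then obtain f :: "nat \<Rightarrow> 'i \<Rightarrow>\<^sub>0 nat" where f: "\<And>i. f (Suc i) < f i" by auto
  have "f j < f i" if "i < j" for i j
    using that by (induction rule: less_Suc_induct) (rule f, rule less_trans)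
  moreover obtain i j z where "i < j" "f j = f i + z"
    using infinite_dominated_pair[of f] by blast
  ultimately show False using le_add_exponent[of "f i" z] by (metis leD)
qed

lemma lookup_single_mult_shift:
  fixes g :: "('i \<Rightarrow>\<^sub>0 nat) \<Rightarrow>\<^sub>0 'a::comm_ring_1"
  shows "Poly_Mapping.lookup (Poly_Mapping.single z c * g) (z + k) = c * Poly_Mapping.lookup g k"
proof (induction g rule: Poly_Mapping.update_induct)
  case const show ?case by simp
next
  case (update g m b)
  then have "Poly_Mapping.update m b g = Poly_Mapping.single m b + g"
    by (intro poly_mapping_eqI)
       (auto simp: lookup_update lookup_add lookup_single when_def in_keys_iff)
  with update show ?case
    by (simp add: distrib_left lookup_add mult_single lookup_single when_def)
qed

text \<open>
  By Dickson's lemma finitely many elements of \<open>I\<close> have leading monomials that divide the leading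
  monomial of every nonzero element of \<open>I\<close>. Dividing by these elements lowers the leading monomial, so the
  division ends at \<open>0\<close>. The conclusion expresses that \<open>F\<close> generates \<open>I\<close> by comparison with all other
  ideals \<open>J\<close>.
\<close>

lemma hilbert_basis:
  fixes I :: "(('i::{finite,linorder} \<Rightarrow>\<^sub>0 nat) \<Rightarrow>\<^sub>0 'a::field) set"
  assumes I: "is_ideal I"
  shows "\<exists>F. finite F \<and> F \<subseteq> I \<and> (\<forall>J. is_ideal J \<longrightarrow> F \<subseteq> J \<longrightarrow> I \<subseteq> J)"
proof -
  define lm where "lm f = Max (Poly_Mapping.keys f)" for f :: "('i \<Rightarrow>\<^sub>0 nat) \<Rightarrow>\<^sub>0 'a"
  from dickson[of "lm ` (I - {0})"] obtain E where E: "finite E" "E \<subseteq> lm ` (I - {0})"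
    and dom: "\<forall>m \<in> lm ` (I - {0}). \<exists>e\<in>E. \<exists>z. m = e + z"
    by (elim exE conjE) (rule that)
  obtain F where F: "F \<subseteq> I - {0}" "finite F" "lm ` F = E"
    using finite_subset_image[OF E] by (elim exE conjE) (rule that, simp_all)
  have "f \<in> J" if J: "is_ideal J" "F \<subseteq> J" and "f \<in> I" "f \<noteq> 0" "lm f = m" for J f m
    using \<open>f \<in> I\<close> \<open>f \<noteq> 0\<close> \<open>lm f = m\<close>
  proof (induction m arbitrary: f rule: wf_induct_rule[OF wf_exponent_less])
    case (1 m)
    have "m \<in> lm ` (I - {0})" using "1.prems" by auto
    then obtain e z where e: "e \<in> lm ` F" "m = e + z" using bspec[OF dom, of m] F(3) by auto
    then obtain g where g: "g \<in> F" and m: "m = lm g + z" by auto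
    have g0: "g \<noteq> 0" "g \<in> I" "g \<in> J" using g F(1) J(2) by auto
    then have "lm g \<in> Poly_Mapping.keys g" by (simp add: lm_def)
    then have lc: "Poly_Mapping.lookup g (lm g) \<noteq> 0" by (simp add: in_keys_iff)
    define c where "c = Poly_Mapping.lookup f m / Poly_Mapping.lookup g (lm g)"
    define q where "q = Poly_Mapping.single z c * g"
    have q: "q \<in> I" "q \<in> J" unfolding q_def using g0 I J by (simp_all add: is_ideal_mult_left)
    have lookup: "Poly_Mapping.lookup (f - q) m = 0"
      unfolding lookup_minus q_def
      using lookup_single_mult_shift[of z c g "lm g"] lc by (simp add: m c_def add.commute)
    have keys: "k < m" if k: "k \<in> Poly_Mapping.keys (f - q)" for k
    proof -
      have "k \<le> m"
      proof (cases "k \<in> Poly_Mapping.keys f")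
        case True
        then show ?thesis using "1.prems"(3) by (auto simp: lm_def)
      next
        case False
        then have "k \<in> Poly_Mapping.keys q"
          using k by (auto simp: in_keys_iff lookup_minus)
        then have "k \<in> {a + b |a b. a \<in> Poly_Mapping.keys (Poly_Mapping.single z c) \<and> b \<in> Poly_Mapping.keys g}"
          unfolding q_def using keys_mult by (rule rev_subsetD)
        then obtain b where "b \<in> Poly_Mapping.keys g" "k = z + b"
          by (auto split: if_splits)
        moreover from this have "b \<le> lm g" by (simp add: lm_def)
        ultimately have "k \<le> z + lm g" by (simp add: add_left_mono)
        then show ?thesis by (simp add: m add.commute)
      qed
      moreover have "k \<noteq> m" using k lookup by (auto simp: in_keys_iff)
      ultimately show ?thesis by simp
    qed
    have "f - q \<in> J"
    proof (cases "f - q = 0")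
      case True then show ?thesis using is_ideal_zero[OF J(1)] by simp
    next
      case False
      then have "lm (f - q) < m" using keys by (simp add: lm_def)
      then show ?thesis
        using "1.IH"[of "lm (f - q)" "f - q"] False is_ideal_diff[OF I "1.prems"(1) q(1)] by simp
    qed
    then have "f - q + q \<in> J" using q(2) by (rule is_ideal_add[OF J(1)])
    then show ?case by simp
  qed
  note division = this
  have "I \<subseteq> J" if J: "is_ideal J" "F \<subseteq> J" for J
  proof
    fix f assume "f \<in> I"
    then show "f \<in> J"
      using is_ideal_zero[OF J(1)] division[OF J, of f] by (cases "f = 0") simp_all
  qed
  with F(1,2) show ?thesis by (intro exI[of _ F]) auto
qed

section \<open>Constants and variables of the polynomial algebra\<close>

lemma Const_add: "Const (a + b) = Const a + Const b"
  and Const_mult: "Const (a * b) = Const a * Const b"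
  and Const_0 [simp]: "Const 0 = 0"
  and Const_1 [simp]: "Const 1 = 1"
  by (simp_all add: Const_def single_add mult_single)

lemma Const_uminus: "Const (- a) = - Const a"
  by (simp add: Const_def single_uminus)

lemma Const_of_nat [simp]: "Const (of_nat n) = of_nat n"
  by (induction n) (simp_all add: Const_add)

lemma Const_numeral [simp]: "Const (numeral n) = numeral n"
  using Const_of_nat[of "numeral n"] by simp

lemma ideal_cancel_Const:
  fixes f :: "'a::field_char_0 poly6"
  assumes "is_ideal I" "c \<noteq> 0" "Const c * f \<in> I"
  shows "f \<in> I"
proof -
  have "Const (inverse c) * (Const c * f) \<in> I"
    by (rule is_ideal_mult_left[OF assms(1,3)])
  also have "Const (inverse c) * (Const c * f) = f"
    using assms(2) by (simp flip: mult.assoc Const_mult)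
  finally show ?thesis .
qed

lemma ideal_cancel_of_nat:
  fixes f :: "'a::field_char_0 poly6"
  assumes "is_ideal I" "n \<noteq> 0" "of_nat n * f \<in> I"
  shows "f \<in> I"
  using ideal_cancel_Const[of I "of_nat n" f] assms by simp

lemma ideal_cancel_numeral:
  fixes f :: "'a::field_char_0 poly6"
  assumes "is_ideal I" "numeral n * f \<in> I"
  shows "f \<in> I"
  using ideal_cancel_Const[of I "numeral n" f] assms by simp

lemma ideal_eq_UNIV_iff: "is_ideal I \<Longrightarrow> I = UNIV \<longleftrightarrow> 1 \<in> I"
  using is_ideal_mult_left[of I 1] by auto

lemma ideal_Const_imp_one: "is_ideal I \<Longrightarrow> c \<noteq> 0 \<Longrightarrow> Const c \<in> I \<Longrightarrow> 1 \<in> I"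
  using ideal_cancel_Const[of I c 1] by simp

lemma exponent_split:
  fixes m :: "6 \<Rightarrow>\<^sub>0 nat"
  assumes "Poly_Mapping.lookup m i \<noteq> 0"
  shows "m = (m - Poly_Mapping.single i 1) + Poly_Mapping.single i 1"
  using assms by (intro poly_mapping_eqI)
    (auto simp: lookup_add lookup_minus lookup_single when_def)

lemma poly6_generators_induct [case_names Const Var add mult]:
  assumes Const: "\<And>c. Q (Const c)" and Var: "\<And>i. Q (Var i)"
    and add: "\<And>p q. Q p \<Longrightarrow> Q q \<Longrightarrow> Q (p + q)"
    and mult: "\<And>p q. Q p \<Longrightarrow> Q q \<Longrightarrow> Q (p * q)"
  shows "Q (p :: 'a::field_char_0 poly6)"
proof (induction p rule: poly6_induct)
  case (single m c)
  show ?case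
  proof (induction "\<Sum>i\<in>UNIV. Poly_Mapping.lookup m i" arbitrary: m rule: less_induct)
    case less
    show ?case
    proof (cases "m = 0")
      case True
      then show ?thesis using Const[of c] by (simp add: Const_def)
    next
      case False
      then obtain i where i: "Poly_Mapping.lookup m i \<noteq> 0"
        by (metis lookup_zero poly_mapping_eqI)
      let ?e = "Poly_Mapping.single i (1::nat)"
      note m = exponent_split[OF i]
      have "(\<Sum>j\<in>UNIV. Poly_Mapping.lookup (m - ?e) j) < (\<Sum>j\<in>UNIV. Poly_Mapping.lookup m j)"
        using i by (intro sum_strict_mono_ex1) (auto simp: lookup_minus lookup_single when_def)
      then have "Q (Poly_Mapping.single (m - ?e) c * Var i)"
        using less Var mult by blast
      also have "Poly_Mapping.single (m - ?e) c * Var i = Poly_Mapping.single m c"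
        by (subst (2) m) (simp add: Var_def mult_single)
      finally show ?thesis .
    qed
  qed
next
  case (sum p q)
  then show ?case by (rule add)
qed

lemma UNIV_six: "(UNIV :: 6 set) = {1, 2, 3, 4, 5, 6}"
  by (rule sym, rule card_subset_eq) auto

lemma six_cases: "i = 1 \<or> i = 2 \<or> i = 3 \<or> i = 4 \<or> i = 5 \<or> i = (6 :: 6)"
  using UNIV_six by auto

section \<open>The Poisson bracket and the centrality of the two invariants\<close>

lemma pdiff_numeral [simp]: "pdiff i (numeral n) = 0"
  using pdiff_Const[of i "numeral n"] by simp

lemma pdiff_power: "pdiff i (p ^ n) = of_nat n * p ^ (n - 1) * pdiff i p"
proof (induction n)
  case 0
  show ?case using pdiff_Const[of i 1] by simp
next
  case (Suc n)
  then show ?case by (cases n) (simp_all add: pdiff_mult algebra_simps)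
qed

lemma pbracket_power: "pbracket f (g ^ n) = of_nat n * g ^ (n - 1) * pbracket f g"
proof (induction n)
  case 0
  show ?case using pbracket_Const_right[of f 1] by simp
next
  case (Suc n)
  then show ?case by (cases n) (simp_all add: pbracket_mult_right algebra_simps)
qed

lemma pbracket_numeral_right [simp]: "pbracket f (numeral n) = 0"
  using pbracket_Const_right[of f "numeral n"] by simp

lemma pbracket_zero_right [simp]: "pbracket f 0 = 0"
  using pbracket_Const_right[of f 0] by simp

lemma pbracket_uminus_right: "pbracket f (- g) = - pbracket f g"
  using pbracket_add_right[of f g "- g"] by (simp add: add_eq_0_iff2)

lemma pbracket_diff_right: "pbracket f (g - h) = pbracket f g - pbracket f h"
  using pbracket_add_right[of f g "- h"] by (simp add: pbracket_uminus_right)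

lemmas pbracket_right_simps =
  pbracket_add_right pbracket_diff_right pbracket_uminus_right pbracket_mult_right pbracket_power

lemma pbracket_Var_right:
  "pbracket f (Var 1) = - 3 * Var 1 * Var 2 * pdiff 2 f + (- Var 1 * Var 3 - Var 2) * pdiff 3 f
     - 2 * Var 3 ^ 2 * pdiff 4 f + (Var 1 * Var 5 - 2 * Var 3) * pdiff 5 f
     + (3 * Var 1 * Var 6 - 3 * Var 5) * pdiff 6 f"
  "pbracket f (Var 2) = 3 * Var 1 * Var 2 * pdiff 1 f - 3 * Var 2 * Var 3 * pdiff 3 f
     + (- 3 * Var 2 * Var 4 - 4 * Var 3 ^ 3) * pdiff 4 f - 6 * Var 3 ^ 2 * pdiff 5 f
     + (3 * Var 2 * Var 6 + 9 * Var 4 - 18 * Var 3 * Var 5) * pdiff 6 f"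
  "pbracket f (Var 3) = (Var 1 * Var 3 + Var 2) * pdiff 1 f + 3 * Var 2 * Var 3 * pdiff 2 f
     - 3 * Var 3 * Var 4 * pdiff 4 f + (- Var 3 * Var 5 - 3 * Var 4) * pdiff 5 f
     - 6 * Var 5 ^ 2 * pdiff 6 f"
  "pbracket f (Var 4) = 2 * Var 3 ^ 2 * pdiff 1 f + (3 * Var 2 * Var 4 + 4 * Var 3 ^ 3) * pdiff 2 f
     + 3 * Var 3 * Var 4 * pdiff 3 f - 3 * Var 4 * Var 5 * pdiff 5 f
     + (- 3 * Var 4 * Var 6 - 4 * Var 5 ^ 3) * pdiff 6 f"
  "pbracket f (Var 5) = (2 * Var 3 - Var 1 * Var 5) * pdiff 1 f + 6 * Var 3 ^ 2 * pdiff 2 f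
     + (Var 3 * Var 5 + 3 * Var 4) * pdiff 3 f + 3 * Var 4 * Var 5 * pdiff 4 f
     - 3 * Var 5 * Var 6 * pdiff 6 f"
  "pbracket f (Var 6) = (3 * Var 5 - 3 * Var 1 * Var 6) * pdiff 1 f
     + (18 * Var 3 * Var 5 - 3 * Var 2 * Var 6 - 9 * Var 4) * pdiff 2 f
     + 6 * Var 5 ^ 2 * pdiff 3 f + (3 * Var 4 * Var 6 + 4 * Var 5 ^ 3) * pdiff 4 f
     + 3 * Var 5 * Var 6 * pdiff 5 f"
  by (simp_all add: pbracket_def jac_def pdiff_Var algebra_simps)

text \<open>
  Clearing denominators makes \<open>\<Omega>\<^sub>1\<close> and \<open>\<Omega>\<^sub>2\<close> integral, so that identities between them and other
  polynomials hold in every commutative ring and are decided by normalisation.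
\<close>

lemma double_Omega1:
  "2 * (Omega1 :: 'a::field_char_0 poly6)
     = 2 * Var 1 * Var 3 * Var 5 - 3 * Var 1 * Var 4 - Var 2 * Var 5 + Var 3 ^ 2"
proof -
  have *: "2 * Const (3/2) = (3 :: 'a poly6)" "2 * Const (1/2) = (1 :: 'a poly6)"
    using Const_mult[of "2 :: 'a" "3/2"] Const_mult[of "2 :: 'a" "1/2"] by simp_all
  have "2 * Omega1 = 2 * Var 1 * Var 3 * Var 5 - (2 * Const (3/2)) * Var 1 * Var 4
          - (2 * Const (1/2)) * Var 2 * Var 5 + (2 * Const (1/2)) * (Var 3 :: 'a poly6) ^ 2"
    unfolding Omega1_def by (simp add: algebra_simps)
  then show ?thesis unfolding * by simp
qed

lemma six_Omega2:
  "6 * (Omega2 :: 'a::field_char_0 poly6) = 6 * Var 2 * Var 4 * Var 6 - 4 * Var 3 ^ 3 * Var 6 - 4 * Var 2 * Var 5 ^ 3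
     + 12 * Var 3 ^ 2 * Var 5 ^ 2 - 18 * Var 3 * Var 4 * Var 5 + 9 * Var 4 ^ 2"
proof -
  have *: "6 * Const (3/2) = (9 :: 'a poly6)" "6 * Const (2/3) = (4 :: 'a poly6)"
    using Const_mult[of "6 :: 'a" "3/2"] Const_mult[of "6 :: 'a" "2/3"] by simp_all
  have "6 * Omega2 = 6 * Var 2 * Var 4 * Var 6 - (6 * Const (2/3)) * Var 3 ^ 3 * Var 6
     - (6 * Const (2/3)) * Var 2 * Var 5 ^ 3
     + 12 * Var 3 ^ 2 * Var 5 ^ 2 - 18 * Var 3 * Var 4 * Var 5 + (6 * Const (3/2)) * (Var 4 :: 'a poly6) ^ 2"
    unfolding Omega2_def by (simp add: algebra_simps)
  then show ?thesis unfolding * .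
qed

lemma Omega1_central: "pbracket f Omega1 = 0"
proof -
  have "2 * pbracket f Omega1 = pbracket f (2 * Omega1)"
    by (simp add: pbracket_mult_right)
  also have "\<dots> = 0"
    unfolding double_Omega1 pbracket_right_simps pbracket_Var_right pbracket_numeral_right
    by (simp add: algebra_simps power2_eq_square power3_eq_cube)
  finally show ?thesis by simp
qed

lemma Omega2_central: "pbracket f Omega2 = 0"
proof -
  have "6 * pbracket f Omega2 = pbracket f (6 * Omega2)"
    by (simp add: pbracket_mult_right)
  also have "\<dots> = 0"
    unfolding six_Omega2 pbracket_right_simps pbracket_Var_right pbracket_numeral_right
    by (simp add: algebra_simps power2_eq_square power3_eq_cube)
  finally show ?thesis by simp
qed

section \<open>Saturations and radicals of Poisson ideals\<close>

lemma power_mult_mono_ideal: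
  assumes "is_ideal I" "w ^ n * f \<in> I" "n \<le> m"
  shows "w ^ m * f \<in> I"
proof -
  have "w ^ m * f = w ^ (m - n) * (w ^ n * f)"
    using assms(3) by (simp flip: mult.assoc power_add)
  then show ?thesis using is_ideal_mult_left[OF assms(1,2)] by metis
qed

lemma power_mono_ideal:
  assumes "is_ideal I" "w ^ n \<in> I" "n \<le> m"
  shows "w ^ m \<in> I"
  using power_mult_mono_ideal[of I w n 1 m] assms by simp

definition saturation :: "'a::comm_ring_1 \<Rightarrow> 'a set \<Rightarrow> 'a set" where
  "saturation w I = {f. \<exists>n. w ^ n * f \<in> I}"

definition radical_of :: "'a::comm_ring_1 set \<Rightarrow> 'a set" where
  "radical_of I = {f. \<exists>n. f ^ n \<in> I}"

lemma saturation_superset: "I \<subseteq> saturation w I"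
  by (auto simp: saturation_def intro: exI[of _ 0])

lemma saturation_cancel:
  assumes "w * f \<in> saturation w I"
  shows "f \<in> saturation w I"
proof -
  from assms obtain n where "w ^ n * (w * f) \<in> I" by (auto simp: saturation_def)
  then have "w ^ Suc n * f \<in> I" by (simp add: mult_ac)
  then show ?thesis unfolding saturation_def by blast
qed

lemma radical_superset: "I \<subseteq> radical_of I"
  by (auto simp: radical_of_def intro: exI[of _ 1])

lemma is_ideal_saturation:
  assumes I: "is_ideal I"
  shows "is_ideal (saturation w I)"
  unfolding ideal_of_type_iff
proof (intro conjI ballI allI)
  show "0 \<in> saturation w I"
    using is_ideal_zero[OF I] by (auto simp: saturation_def)
next
  fix a b assume "a \<in> saturation w I" "b \<in> saturation w I"
  then obtain n m where nm: "w ^ n * a \<in> I" "w ^ m * b \<in> I" by (auto simp: saturation_def)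
  have "w ^ (n + m) * a + w ^ (n + m) * b \<in> I"
    by (intro is_ideal_add[OF I] power_mult_mono_ideal[OF I nm(1)] power_mult_mono_ideal[OF I nm(2)])
       simp_all
  then show "a + b \<in> saturation w I"
    unfolding saturation_def by (metis (mono_tags) mem_Collect_eq distrib_left)
next
  fix a c assume "a \<in> saturation w I"
  then obtain n where n: "w ^ n * a \<in> I" by (auto simp: saturation_def)
  have "w ^ n * (c * a) \<in> I"
    using is_ideal_mult_left[OF I n, of c] by (simp add: mult_ac)
  then show "c * a \<in> saturation w I" unfolding saturation_def by blast
qed

lemma is_ideal_radical:
  assumes I: "is_ideal I"
  shows "is_ideal (radical_of I)"
  unfolding ideal_of_type_iff
proof (intro conjI ballI allI)
  show "0 \<in> radical_of I"
    using is_ideal_zero[OF I] radical_superset by blast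
next
  fix a b assume "a \<in> radical_of I" "b \<in> radical_of I"
  then obtain n m where nm: "a ^ n \<in> I" "b ^ m \<in> I" by (auto simp: radical_of_def)
  have "of_nat (n + m choose k) * a ^ k * b ^ (n + m - k) \<in> I" for k
  proof (cases "n \<le> k")
    case True
    then have "a ^ k \<in> I" by (rule power_mono_ideal[OF I nm(1)])
    then show ?thesis by (intro is_ideal_mult_right[OF I] is_ideal_mult_left[OF I])
  next
    case False
    then have "b ^ (n + m - k) \<in> I" by (intro power_mono_ideal[OF I nm(2)]) simp
    then show ?thesis by (intro is_ideal_mult_left[OF I])
  qed
  then have "(\<Sum>k\<in>A. of_nat (n + m choose k) * a ^ k * b ^ (n + m - k)) \<in> I" for A
    by (induction A rule: infinite_finite_induct) (simp_all add: is_ideal_closed[OF I])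
  then have "(a + b) ^ (n + m) \<in> I" unfolding binomial_ring .
  then show "a + b \<in> radical_of I" unfolding radical_of_def by blast
next
  fix a c assume "a \<in> radical_of I"
  then obtain n where "a ^ n \<in> I" by (auto simp: radical_of_def)
  then have "(c * a) ^ n \<in> I" by (simp add: power_mult_distrib is_ideal_mult_left[OF I])
  then show "c * a \<in> radical_of I" unfolding radical_of_def by blast
qed

lemma radical_power_imp:
  assumes "f ^ n \<in> radical_of I"
  shows "f \<in> radical_of I"
  using assms by (auto simp: radical_of_def simp flip: power_mult)

lemma poisson_idealD:
  assumes "poisson_ideal I"
  shows "is_ideal I" "\<And>g. g \<in> I \<Longrightarrow> pbracket f g \<in> I"
  using assms by (auto simp: poisson_ideal_def)

lemma mult_pbracket_power: "g * pbracket f (g ^ n) = of_nat n * pbracket f g * g ^ n"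
  unfolding pbracket_power by (cases n) (simp_all add: algebra_simps)

text \<open>
  From \<open>w\<^sup>n g \<in> I\<close> the Leibniz rule gives \<open>w\<^sup>n\<^sup>+\<^sup>1 {f, g} \<in> I\<close>: one more factor \<open>w\<close> turns the term
  with \<open>{f, w\<^sup>n}\<close> into a multiple of \<open>w\<^sup>n g\<close>.
\<close>

lemma poisson_ideal_saturation:
  assumes I: "poisson_ideal I"
  shows "poisson_ideal (saturation w I)"
  unfolding poisson_ideal_def
proof (intro conjI allI ballI)
  note ideal = poisson_idealD(1)[OF I]
  show "is_ideal (saturation w I)" by (rule is_ideal_saturation[OF ideal])
  fix f g assume "g \<in> saturation w I"
  then obtain n where n: "w ^ n * g \<in> I" by (auto simp: saturation_def)
  have eq: "w * pbracket f (w ^ n * g)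
      = w * pbracket f (w ^ n) * g + w ^ Suc n * pbracket f g"
    by (simp add: pbracket_mult_right algebra_simps)
  have "w * pbracket f (w ^ n * g) - of_nat n * pbracket f w * (w ^ n * g) \<in> I"
    by (intro is_ideal_diff[OF ideal] is_ideal_mult_left[OF ideal] poisson_idealD(2)[OF I] n)
  also have "w * pbracket f (w ^ n * g) - of_nat n * pbracket f w * (w ^ n * g)
      = w ^ Suc n * pbracket f g"
    unfolding eq mult_pbracket_power by (simp add: algebra_simps)
  finally show "pbracket f g \<in> saturation w I" unfolding saturation_def by blast
qed

text \<open>
  Let \<open>g\<^sup>n \<in> I\<close>. Bracketing with \<open>f\<close> trades one factor \<open>g\<close> for two factors \<open>{f, g}\<close>, up to the
  integer coefficients that are invertible in characteristic zero; so \<open>{f, g}\<^sup>2\<^sup>n \<in> I\<close>.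
\<close>

lemma poisson_ideal_radical:
  assumes I: "poisson_ideal I"
  shows "poisson_ideal (radical_of I)"
  unfolding poisson_ideal_def
proof (intro conjI allI ballI)
  note ideal = poisson_idealD(1)[OF I]
  show "is_ideal (radical_of I)" by (rule is_ideal_radical[OF ideal])
  fix f g assume "g \<in> radical_of I"
  then obtain n where n: "g ^ n \<in> I" by (auto simp: radical_of_def)
  let ?d = "pbracket f g"
  have "g ^ (n - k) * ?d ^ (2 * k) \<in> I" if "k \<le> n" for k
    using that
  proof (induction k)
    case 0
    show ?case using n by simp
  next
    case (Suc k)
    define m where "m = n - Suc k"
    have m: "n - k = Suc m" using Suc.prems by (simp add: m_def)
    let ?x = "g ^ Suc m * ?d ^ (2 * k)"
    have x: "?x \<in> I" using Suc m by simp
    have eq: "?d * pbracket f ?x = ?d * pbracket f (g ^ Suc m) * ?d ^ (2 * k)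
        + g ^ Suc m * (?d * pbracket f (?d ^ (2 * k)))"
      by (simp add: pbracket_mult_right algebra_simps)
    have "?d * pbracket f ?x - of_nat (2 * k) * pbracket f ?d * ?x \<in> I"
      by (intro is_ideal_diff[OF ideal] is_ideal_mult_left[OF ideal] poisson_idealD(2)[OF I] x)
    also have "?d * pbracket f ?x - of_nat (2 * k) * pbracket f ?d * ?x
        = of_nat (Suc m) * (g ^ m * ?d ^ (2 * Suc k))"
      unfolding eq mult_pbracket_power pbracket_power[of f g] by (simp add: algebra_simps)
    finally show ?case
      unfolding m_def[symmetric] by (rule ideal_cancel_of_nat[OF ideal, rotated]) simp
  qed
  from this[of n] have "?d ^ (2 * n) \<in> I" by simp
  then show "?d \<in> radical_of I" unfolding radical_of_def by blast
qed

section \<open>Polynomials in the four middle variables\<close>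

text \<open>
  The subalgebra \<open>K[X\<^sub>2, X\<^sub>3, X\<^sub>4, X\<^sub>5]\<close>. As an inductive set it comes with the induction principle over
  generators that derivations and ring homomorphisms call for.
\<close>

inductive_set middle_polys :: "'a::field_char_0 poly6 set" where
  Const: "Const c \<in> middle_polys"
| Var: "i \<in> {2, 3, 4, 5} \<Longrightarrow> Var i \<in> middle_polys"
| add: "f \<in> middle_polys \<Longrightarrow> g \<in> middle_polys \<Longrightarrow> f + g \<in> middle_polys"
| mult: "f \<in> middle_polys \<Longrightarrow> g \<in> middle_polys \<Longrightarrow> f * g \<in> middle_polys"

lemma middle_polys_uminus: "f \<in> middle_polys \<Longrightarrow> - f \<in> middle_polys"
  using middle_polys.mult[OF middle_polys.Const[of "- 1"]] by (simp add: Const_uminus)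

lemma middle_polys_diff: "f \<in> middle_polys \<Longrightarrow> g \<in> middle_polys \<Longrightarrow> f - g \<in> middle_polys"
  using middle_polys.add[OF _ middle_polys_uminus] by fastforce

lemma middle_polys_power: "f \<in> middle_polys \<Longrightarrow> f ^ n \<in> middle_polys"
  by (induction n) (use middle_polys.Const[of 1] in \<open>simp_all add: middle_polys.mult\<close>)

lemma middle_polys_numeral: "numeral n \<in> middle_polys"
  using middle_polys.Const[of "numeral n"] by simp

lemmas middle_polys_intros =
  middle_polys.intros middle_polys_uminus middle_polys_diff middle_polys_power middle_polys_numeral

lemma middle_polys_zero_one: "0 \<in> middle_polys" "1 \<in> middle_polys"
  using middle_polys.Const[of 0] middle_polys.Const[of 1] by simp_all

lemma pdiff_middle_polys_zero:
  assumes "g \<in> middle_polys"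
  shows "pdiff 1 g = 0" "pdiff 6 g = 0"
  using assms by (induction) (auto simp: pdiff_Var pdiff_add pdiff_mult)

lemma pdiff_middle_polys:
  assumes "g \<in> middle_polys"
  shows "pdiff i g \<in> middle_polys"
  using assms
  by induction
     (auto simp: pdiff_Var pdiff_add pdiff_mult intro!: middle_polys.intros middle_polys_zero_one)

lemma lookup_pdiff:
  "Poly_Mapping.lookup (pdiff i f) m
     = of_nat (Poly_Mapping.lookup m i + 1) * Poly_Mapping.lookup f (m + Poly_Mapping.single i 1)"
proof (induction f rule: poly6_induct)
  case (single k c)
  show ?case
  proof (cases "Poly_Mapping.lookup k i = 0")
    case True
    then have "k \<noteq> m + Poly_Mapping.single i 1" by (auto simp: lookup_add)
    with True show ?thesis by (simp add: pdiff_single lookup_single)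
  next
    case False
    then have "k - Poly_Mapping.single i 1 = m \<longleftrightarrow> k = m + Poly_Mapping.single i 1"
      using exponent_split[of k i] by (metis add_right_cancel)
    then show ?thesis by (auto simp: pdiff_single lookup_single when_def lookup_add)
  qed
next
  case (sum p q)
  then show ?case by (simp add: pdiff_add lookup_add algebra_simps)
qed

text \<open>
  Characteristic zero enters here: the exponent \<open>n\<close> in \<open>\<partial> X\<^sup>n = n X\<^sup>n\<^sup>-\<^sup>1\<close> is invertible.
\<close>

lemma all_pdiff_zero_imp_Const:
  assumes "\<And>i. pdiff i f = 0"
  shows "f = Const (Poly_Mapping.lookup f 0)"
proof (rule poly_mapping_eqI)
  fix m
  show "Poly_Mapping.lookup f m = Poly_Mapping.lookup (Const (Poly_Mapping.lookup f 0)) m"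
  proof (cases "m = 0")
    case False
    then obtain i where i: "Poly_Mapping.lookup m i \<noteq> 0"
      by (metis lookup_zero poly_mapping_eqI)
    let ?k = "m - Poly_Mapping.single i 1"
    have "of_nat (Poly_Mapping.lookup ?k i + 1) * Poly_Mapping.lookup f m = 0"
      using lookup_pdiff[of i f ?k] assms[of i] exponent_split[OF i] by simp
    then have "Poly_Mapping.lookup f m = 0"
      using of_nat_neq_0[where ?'a = 'a] by (simp del: of_nat_add of_nat_Suc)
    with False show ?thesis by (simp add: Const_def lookup_single)
  qed (simp add: Const_def)
qed

text \<open>
  Differentiate a nonzero element until all its derivatives vanish. The degree drops at each step, and
  what remains is a nonzero constant.
\<close>

lemma ideal_with_stable_slice:
  fixes I :: "'a::field_char_0 poly6 set"
  assumes I: "is_ideal I"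
    and stable: "\<And>g i. g \<in> I \<Longrightarrow> g \<in> middle_polys \<Longrightarrow> pdiff i g \<in> I"
    and g: "g \<in> I" "g \<in> middle_polys" "g \<noteq> 0"
  shows "1 \<in> I"
proof -
  have "1 \<in> I" if "\<forall>m\<in>Poly_Mapping.keys g. (\<Sum>i\<in>UNIV. Poly_Mapping.lookup m i) < n" for n
    using that g
  proof (induction n arbitrary: g)
    case 0
    then have "Poly_Mapping.keys g = {}" by auto
    with 0 show ?case by simp
  next
    case (Suc n)
    show ?case
    proof (cases "\<forall>i. pdiff i g = 0")
      case True
      then have "g = Const (Poly_Mapping.lookup g 0)" by (intro all_pdiff_zero_imp_Const) simp
      with Suc.prems ideal_Const_imp_one[OF I] show ?thesis by (metis Const_0)
    next
      case False
      then obtain i where i: "pdiff i g \<noteq> 0" by blast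
      have "(\<Sum>j\<in>UNIV. Poly_Mapping.lookup m j) < n" if "m \<in> Poly_Mapping.keys (pdiff i g)" for m
      proof -
        have "m + Poly_Mapping.single i 1 \<in> Poly_Mapping.keys g"
          using that by (auto simp: in_keys_iff lookup_pdiff)
        then have "(\<Sum>j\<in>UNIV. Poly_Mapping.lookup (m + Poly_Mapping.single i 1) j) < Suc n"
          using Suc.prems(1) by blast
        then show ?thesis
          by (simp add: lookup_add sum.distrib lookup_single when_def)
      qed
      then show ?thesis
        using Suc.IH[of "pdiff i g"] Suc.prems i stable pdiff_middle_polys by blast
    qed
  qed
  moreover have "\<exists>n. \<forall>m\<in>Poly_Mapping.keys g. (\<Sum>i\<in>UNIV. Poly_Mapping.lookup m i) < n"
    using finite_imageI[OF finite_keys, of "\<lambda>m. \<Sum>i\<in>UNIV. Poly_Mapping.lookup m i" g]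
    by (metis (no_types, lifting) finite_nat_set_iff_bounded imageI)
  ultimately show ?thesis by blast
qed

section \<open>Substitution into polynomials\<close>

definition eval_fract :: "(6 \<Rightarrow> 'a::field_char_0 poly6 fract) \<Rightarrow> 'a poly6 \<Rightarrow> 'a poly6 fract" where
  "eval_fract v f = (\<Sum>m\<in>Poly_Mapping.keys f.
     to_fract (Const (Poly_Mapping.lookup f m)) * (\<Prod>i\<in>UNIV. v i ^ Poly_Mapping.lookup m i))"

lemma eval_fract_superset:
  assumes "finite A" "Poly_Mapping.keys f \<subseteq> A"
  shows "eval_fract v f = (\<Sum>m\<in>A.
     to_fract (Const (Poly_Mapping.lookup f m)) * (\<Prod>i\<in>UNIV. v i ^ Poly_Mapping.lookup m i))"
  unfolding eval_fract_def
  by (rule sum.mono_neutral_left) (use assms in \<open>auto simp: in_keys_iff\<close>)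

lemma eval_fract_single:
  "eval_fract v (Poly_Mapping.single m c)
     = to_fract (Const c) * (\<Prod>i\<in>UNIV. v i ^ Poly_Mapping.lookup m i)"
  by (subst eval_fract_superset[of "{m}"]) auto

lemma eval_fract_add: "eval_fract v (f + g) = eval_fract v f + eval_fract v g"
proof -
  let ?A = "Poly_Mapping.keys f \<union> Poly_Mapping.keys g"
  have "Poly_Mapping.keys (f + g) \<subseteq> ?A" by (rule Poly_Mapping.keys_add)
  then show ?thesis
    by (simp add: eval_fract_superset[of ?A] lookup_add Const_add distrib_right sum.distrib)
qed

lemma eval_fract_mult: "eval_fract v (f * g) = eval_fract v f * eval_fract v g"
proof (induction f rule: poly6_induct)
  case (single m c)
  show ?case
  proof (induction g rule: poly6_induct)
    case (single n d)
    show ?case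
      by (simp add: mult_single eval_fract_single Const_mult lookup_add power_add prod.distrib mult_ac)
  next
    case (sum p q)
    then show ?case by (simp add: distrib_left eval_fract_add)
  qed
next
  case (sum p q)
  then show ?case by (simp add: distrib_right eval_fract_add)
qed

lemma eval_fract_Const [simp]: "eval_fract v (Const c) = to_fract (Const c)"
  by (simp add: Const_def[of c] eval_fract_single)

lemma eval_fract_Var [simp]: "eval_fract v (Var i) = v i"
proof -
  have "(\<Prod>j\<in>UNIV. v j ^ Poly_Mapping.lookup (Poly_Mapping.single i (1::nat)) j)
      = (\<Prod>j\<in>UNIV. if j = i then v j else 1)"
    by (intro prod.cong) (auto simp: lookup_single when_def)
  then show ?thesis by (simp add: Var_def eval_fract_single)
qed

lemma eval_fract_uminus: "eval_fract v (- f) = - eval_fract v f"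
  using eval_fract_mult[of v "Const (- 1)" f] unfolding eval_fract_Const by (simp add: Const_uminus)

lemma eval_fract_diff: "eval_fract v (f - g) = eval_fract v f - eval_fract v g"
  using eval_fract_add[of v f "- g"] by (simp add: eval_fract_uminus)

lemma eval_fract_0_1 [simp]: "eval_fract v 0 = 0" "eval_fract v 1 = 1"
  using eval_fract_Const[of v 0] eval_fract_Const[of v 1] by (simp_all del: eval_fract_Const)

lemma eval_fract_numeral [simp]: "eval_fract v (numeral n) = to_fract (numeral n)"
  using eval_fract_Const[of v "numeral n"] by (simp del: eval_fract_Const)

lemma eval_fract_power: "eval_fract v (f ^ n) = eval_fract v f ^ n"
  by (induction n) (simp_all add: eval_fract_mult)

lemma is_ideal_kernel: "is_ideal {f. eval_fract v f = 0}"
  unfolding ideal_of_type_iff by (simp add: eval_fract_add eval_fract_mult)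

lemma eval_fract_middle_polys:
  assumes "g \<in> middle_polys" and "\<And>i. i \<in> {2, 3, 4, 5} \<Longrightarrow> v i = to_fract (Var i)"
  shows "eval_fract v g = to_fract g"
  using assms(1) by induction (use assms(2) in \<open>auto simp: eval_fract_add eval_fract_mult\<close>)

section \<open>The two slopes and the Pfaffian\<close>

text \<open>
  The decompositions \<open>2 \<Omega>\<^sub>1 = X\<^sub>1 slope1 + rest1\<close> and \<open>6 \<Omega>\<^sub>2 = X\<^sub>6 slope2 + rest2\<close>, in which all four
  polynomials involve the middle variables only.
\<close>

definition slope1 :: "'a::field_char_0 poly6" where
  "slope1 = 2 * Var 3 * Var 5 - 3 * Var 4"

definition slope2 :: "'a::field_char_0 poly6" where
  "slope2 = 6 * Var 2 * Var 4 - 4 * Var 3 ^ 3"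

definition rest1 :: "'a::field_char_0 poly6" where
  "rest1 = Var 3 ^ 2 - Var 2 * Var 5"

definition rest2 :: "'a::field_char_0 poly6" where
  "rest2 = 9 * Var 4 ^ 2 - 18 * Var 3 * Var 4 * Var 5 - 4 * Var 2 * Var 5 ^ 3
     + 12 * Var 3 ^ 2 * Var 5 ^ 2"

abbreviation slopes :: "'a::field_char_0 poly6" where
  "slopes \<equiv> slope1 * slope2"

lemma Omega1_linear: "2 * Omega1 = Var 1 * slope1 + rest1"
  unfolding double_Omega1 by (simp add: slope1_def rest1_def algebra_simps)

lemma Omega2_linear: "6 * Omega2 = Var 6 * slope2 + rest2"
  unfolding six_Omega2 by (simp add: slope2_def rest2_def algebra_simps)

lemma middle_polys_slopes:
  "slope1 \<in> middle_polys" "slope2 \<in> middle_polys" "rest1 \<in> middle_polys" "rest2 \<in> middle_polys"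
  unfolding slope1_def slope2_def rest1_def rest2_def by (intro middle_polys_intros; simp)+

lemma slope1_nonzero: "slope1 \<noteq> 0"
proof
  assume "slope1 = (0 :: 'a poly6)"
  then have *: "3 * Var 4 = (2 * Var 3 * Var 5 :: 'a poly6)" by (simp add: slope1_def)
  have "pdiff 4 (3 * Var 4) = (3 :: 'a poly6)"
    by (simp add: pdiff_mult pdiff_Var)
  moreover have "pdiff 4 (2 * Var 3 * Var 5) = (0 :: 'a poly6)"
    by (simp add: pdiff_mult pdiff_Var)
  ultimately show False unfolding * by simp
qed

lemma slope2_nonzero: "slope2 \<noteq> 0"
proof
  assume "slope2 = (0 :: 'a poly6)"
  then have *: "6 * Var 2 * Var 4 = (4 * Var 3 ^ 3 :: 'a poly6)" by (simp add: slope2_def)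
  have "pdiff 4 (pdiff 2 (6 * Var 2 * Var 4)) = (6 :: 'a poly6)"
    by (simp add: pdiff_mult pdiff_Var)
  moreover have "pdiff 4 (pdiff 2 (4 * Var 3 ^ 3)) = (0 :: 'a poly6)"
    by (simp add: pdiff_mult pdiff_Var pdiff_power)
  ultimately show False unfolding * by simp
qed

lemma pbracket_slopes:
  "pbracket (Var 1) slope1 = - 2 * rest1"
  "pbracket (Var 1) slope2 = 3 * Var 1 * slope2"
  "pbracket (Var 6) slope2 = 6 * rest2"
  unfolding slope1_def slope2_def rest1_def rest2_def pbracket_right_simps pbracket_numeral_right
  by (simp_all add: pbracket_Var pbracket_skew[of "Var 1"] algebra_simps power2_eq_square power3_eq_cube)

text \<open>
  The first relation is a cube modulo \<open>slope2\<close>: on the hypersurface \<open>slope2 = 0\<close> the vanishing of \<open>rest2\<close>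
  forces that of \<open>slope1\<close>. The other two say that \<open>slope2\<close> and \<open>rest2\<close>, and with them \<open>\<Omega>\<^sub>2\<close>, vanish where
  \<open>slope1\<close> and \<open>rest1\<close> do.
\<close>

lemma slope_relations:
  "3 * Var 4 * rest2 + slope1 ^ 3 = - 2 * slope2 * Var 5 ^ 3"
  "slope2 = - 4 * Var 3 * rest1 - 2 * Var 2 * slope1"
  "rest2 = 4 * Var 5 ^ 2 * rest1 + 2 * Var 3 * Var 5 * slope1 + slope1 ^ 2"
  unfolding slope1_def slope2_def rest1_def rest2_def
  by (simp_all add: algebra_simps power2_eq_square power3_eq_cube)

text \<open>
  The inverse of a skew-symmetric \<open>4 \<times> 4\<close> matrix, times its Pfaffian \<open>a f - b e + c d\<close>. The upper
  triangle is \<open>a, b, c\<close> in row one, \<open>d, e\<close> in row two and \<open>f\<close> in row three; the bracketed sums are the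
  entries of the image of the vector \<open>(x, y, z, w)\<close>.
\<close>

lemma pfaffian_inverse:
  fixes a b c d e f x y z w :: "'a::comm_ring_1"
  shows
    "(a * f - b * e + c * d) * x
       = - f * (d * z + e * w - a * x) + e * (f * w - b * x - d * y) - d * (- c * x - e * y - f * z)"
    "(a * f - b * e + c * d) * y
       = f * (a * y + b * z + c * w) - c * (f * w - b * x - d * y) + b * (- c * x - e * y - f * z)"
    "(a * f - b * e + c * d) * z
       = - e * (a * y + b * z + c * w) + c * (d * z + e * w - a * x) - a * (- c * x - e * y - f * z)"
    "(a * f - b * e + c * d) * w
       = d * (a * y + b * z + c * w) - b * (d * z + e * w - a * x) + a * (f * w - b * x - d * y)"
  by (simp_all add: algebra_simps)

text \<open>
  On the middle variables the brackets \<open>{X\<^sub>j, g}\<close> arise from the partial derivatives of \<open>g\<close> through a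
  skew-symmetric matrix with Pfaffian \<open>slope1 slope2 / 2\<close>; inverting it recovers the derivatives.
\<close>

lemma slopes_pdiff_hamiltonian:
  fixes g :: "'a::field_char_0 poly6"
  assumes "g \<in> middle_polys"
  defines "a \<equiv> 3 * Var 2 * Var 3" and "b \<equiv> 3 * Var 2 * Var 4 + 4 * Var 3 ^ 3"
    and "c \<equiv> 6 * Var 3 ^ 2" and "d \<equiv> 3 * Var 3 * Var 4"
    and "e \<equiv> Var 3 * Var 5 + 3 * Var 4" and "f \<equiv> 3 * Var 4 * Var 5"
  defines "y2 \<equiv> pbracket (Var 2) g" and "y3 \<equiv> pbracket (Var 3) g"
    and "y4 \<equiv> pbracket (Var 4) g" and "y5 \<equiv> pbracket (Var 5) g"
  shows "slopes * pdiff 2 g = 2 * (- f * y3 + e * y4 - d * y5)"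
    "slopes * pdiff 3 g = 2 * (f * y2 - c * y4 + b * y5)"
    "slopes * pdiff 4 g = 2 * (- e * y2 + c * y3 - a * y5)"
    "slopes * pdiff 5 g = 2 * (d * y2 - b * y3 + a * y4)"
proof -
  have y: "y2 = a * pdiff 3 g + b * pdiff 4 g + c * pdiff 5 g"
    "y3 = d * pdiff 4 g + e * pdiff 5 g - a * pdiff 2 g"
    "y4 = f * pdiff 5 g - b * pdiff 2 g - d * pdiff 3 g"
    "y5 = - c * pdiff 2 g - e * pdiff 3 g - f * pdiff 4 g"
    unfolding y2_def y3_def y4_def y5_def a_def b_def c_def d_def e_def f_def
      pbracket_skew[of "Var _" g] pbracket_Var_right pdiff_middle_polys_zero[OF assms(1)]
    by (simp_all add: algebra_simps)
  have pfaffian: "slopes = 2 * (a * f - b * e + c * d)"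
    unfolding slope1_def slope2_def a_def b_def c_def d_def e_def f_def
    by (simp add: algebra_simps power2_eq_square power3_eq_cube)
  show "slopes * pdiff 2 g = 2 * (- f * y3 + e * y4 - d * y5)"
    unfolding pfaffian y mult.assoc[of 2] by (subst pfaffian_inverse(1)) (rule refl)
  show "slopes * pdiff 3 g = 2 * (f * y2 - c * y4 + b * y5)"
    unfolding pfaffian y mult.assoc[of 2] by (subst pfaffian_inverse(2)) (rule refl)
  show "slopes * pdiff 4 g = 2 * (- e * y2 + c * y3 - a * y5)"
    unfolding pfaffian y mult.assoc[of 2] by (subst pfaffian_inverse(3)) (rule refl)
  show "slopes * pdiff 5 g = 2 * (d * y2 - b * y3 + a * y4)"
    unfolding pfaffian y mult.assoc[of 2] by (subst pfaffian_inverse(4)) (rule refl)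
qed

section \<open>Poisson ideals meeting the middle variables\<close>

lemma slopes_pdiff_in_poisson_ideal:
  assumes J: "poisson_ideal J" and g: "g \<in> J" "g \<in> middle_polys"
  shows "slopes * pdiff i g \<in> J"
proof -
  note ideal = poisson_idealD(1)[OF J]
  note closed = is_ideal_add[OF ideal] is_ideal_diff[OF ideal] is_ideal_mult_left[OF ideal]
    poisson_idealD(2)[OF J g(1)]
  have "slopes * pdiff 2 g \<in> J" "slopes * pdiff 3 g \<in> J"
    "slopes * pdiff 4 g \<in> J" "slopes * pdiff 5 g \<in> J"
    unfolding slopes_pdiff_hamiltonian[OF g(2)] by (rule closed)+
  then show ?thesis
    using six_cases[of i] pdiff_middle_polys_zero[OF g(2)] is_ideal_zero[OF ideal] by auto
qed

text \<open>
  The saturation of \<open>J\<close> by the slopes is stable under \<open>w \<partial>\<^sub>i\<close> on middle polynomials, where \<open>w\<close> is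
  the product of the slopes, and being saturated it is stable under \<open>\<partial>\<^sub>i\<close> itself.
\<close>

lemma slopes_power_in_poisson_ideal:
  assumes J: "poisson_ideal J" and g: "g \<in> J" "g \<in> middle_polys" "g \<noteq> 0"
  shows "\<exists>n. slopes ^ n \<in> J"
proof -
  let ?I = "saturation slopes J"
  note I = poisson_ideal_saturation[OF J, of slopes]
  have "1 \<in> ?I"
  proof (rule ideal_with_stable_slice[OF poisson_idealD(1)[OF I] _ _ g(2,3)])
    show "g \<in> ?I" using g(1) saturation_superset by blast
    show "pdiff i h \<in> ?I" if "h \<in> ?I" "h \<in> middle_polys" for h i
      using slopes_pdiff_in_poisson_ideal[OF I that] by (rule saturation_cancel)
  qed
  then show ?thesis by (simp add: saturation_def)
qed

section \<open>The ideal of a level set\<close>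

context
  fixes \<alpha> \<beta> :: "'a::field_char_0"
begin

definition level_ideal :: "'a poly6 set" where
  "level_ideal = genideal poly6_ring {Omega1 - Const \<alpha>, Omega2 - Const \<beta>}"

lemma is_ideal_level_ideal: "is_ideal level_ideal"
  unfolding level_ideal_def
  by (rule ring.genideal_ideal[OF ring_from_type_algebra]) (simp add: ring_of_type_algebra_def)

lemma level_ideal_generators:
  "Omega1 - Const \<alpha> \<in> level_ideal" "Omega2 - Const \<beta> \<in> level_ideal"
  using ring.genideal_self[OF ring_from_type_algebra,
      of "{Omega1 - Const \<alpha>, Omega2 - Const \<beta>}"]
  by (simp_all add: level_ideal_def ring_of_type_algebra_def)

lemma level_ideal_minimal:
  assumes "is_ideal I" "Omega1 - Const \<alpha> \<in> I" "Omega2 - Const \<beta> \<in> I"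
  shows "level_ideal \<subseteq> I"
  unfolding level_ideal_def
  by (rule ring.genideal_minimal[OF ring_from_type_algebra]) (use assms in auto)

lemma poisson_ideal_level_ideal: "poisson_ideal level_ideal"
proof -
  note P = is_ideal_level_ideal
  have "level_ideal \<subseteq> {g. g \<in> level_ideal \<and> (\<forall>f. pbracket f g \<in> level_ideal)}"
  proof (rule level_ideal_minimal)
    show "is_ideal {g. g \<in> level_ideal \<and> (\<forall>f. pbracket f g \<in> level_ideal)}"
      unfolding ideal_of_type_iff
      by (auto simp: pbracket_add_right pbracket_mult_right
          intro!: is_ideal_zero[OF P] is_ideal_add[OF P] is_ideal_mult_left[OF P])
  qed (use level_ideal_generators is_ideal_zero[OF P] in
      \<open>auto simp: pbracket_diff_right Omega1_central Omega2_central\<close>)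
  with P show ?thesis by (auto simp: poisson_ideal_def)
qed

lemma level_ideal_linear:
  "slope1 * Var 1 - (2 * Const \<alpha> - rest1) \<in> level_ideal"
  "slope2 * Var 6 - (6 * Const \<beta> - rest2) \<in> level_ideal"
proof -
  have "2 * (Omega1 - Const \<alpha>) \<in> level_ideal" "6 * (Omega2 - Const \<beta>) \<in> level_ideal"
    by (intro is_ideal_mult_left[OF is_ideal_level_ideal] level_ideal_generators)+
  then show "slope1 * Var 1 - (2 * Const \<alpha> - rest1) \<in> level_ideal"
    "slope2 * Var 6 - (6 * Const \<beta> - rest2) \<in> level_ideal"
    by (simp_all only: right_diff_distrib Omega1_linear Omega2_linear) (simp_all add: algebra_simps)
qed

text \<open>
  Modulo the ideal, \<open>slope1 X\<^sub>1\<close> and \<open>slope2 X\<^sub>6\<close> are middle polynomials, so enough factors of the slopes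
  eliminate the outer variables.
\<close>

lemma level_ideal_pseudo_reduction:
  "\<exists>n g. g \<in> middle_polys \<and> slopes ^ n * f - g \<in> level_ideal"
proof (induction f rule: poly6_generators_induct)
  case (Const c)
  show ?case
    using is_ideal_zero[OF is_ideal_level_ideal]
    by (intro exI[of _ 0] exI[of _ "Const c"]) (simp add: middle_polys.Const)
next
  case (Var i)
  note P = is_ideal_level_ideal
  note closed = middle_polys_intros middle_polys_slopes
  consider "i \<in> {2, 3, 4, 5}" | "i = 1" | "i = 6" using six_cases[of i] by auto
  then show ?case
  proof cases
    case 1
    then show ?thesis
      using is_ideal_zero[OF P]
      by (intro exI[of _ 0] exI[of _ "Var i"]) (simp add: middle_polys.Var)
  next
    case 2
    have "slopes ^ 1 * Var i - slope2 * (2 * Const \<alpha> - rest1) \<in> level_ideal"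
      using is_ideal_mult_left[OF P level_ideal_linear(1), of slope2] 2
      by (simp add: algebra_simps)
    moreover have "slope2 * (2 * Const \<alpha> - rest1) \<in> middle_polys"
      by (intro closed)
    ultimately show ?thesis by blast
  next
    case 3
    have "slopes ^ 1 * Var i - slope1 * (6 * Const \<beta> - rest2) \<in> level_ideal"
      using is_ideal_mult_left[OF P level_ideal_linear(2), of slope1] 3
      by (simp add: algebra_simps)
    moreover have "slope1 * (6 * Const \<beta> - rest2) \<in> middle_polys"
      by (intro closed)
    ultimately show ?thesis by blast
  qed
next
  case (add p q)
  note P = is_ideal_level_ideal
  from add obtain n g m h where *: "g \<in> middle_polys" "slopes ^ n * p - g \<in> level_ideal"
    "h \<in> middle_polys" "slopes ^ m * q - h \<in> level_ideal" by blast
  have "slopes ^ m * (slopes ^ n * p - g) + slopes ^ n * (slopes ^ m * q - h) \<in> level_ideal"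
    by (intro is_ideal_add[OF P] is_ideal_mult_left[OF P] *)
  also have "slopes ^ m * (slopes ^ n * p - g) + slopes ^ n * (slopes ^ m * q - h)
      = slopes ^ (n + m) * (p + q) - (slopes ^ m * g + slopes ^ n * h)"
    by (simp add: power_add algebra_simps)
  finally show ?case
    using * by (intro exI[of _ "n + m"] exI[of _ "slopes ^ m * g + slopes ^ n * h"] conjI
        middle_polys_intros middle_polys_slopes)
next
  case (mult p q)
  note P = is_ideal_level_ideal
  from mult obtain n g m h where *: "g \<in> middle_polys" "slopes ^ n * p - g \<in> level_ideal"
    "h \<in> middle_polys" "slopes ^ m * q - h \<in> level_ideal" by blast
  have "slopes ^ m * q * (slopes ^ n * p - g) + g * (slopes ^ m * q - h) \<in> level_ideal"
    by (intro is_ideal_add[OF P] is_ideal_mult_left[OF P] *)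
  also have "slopes ^ m * q * (slopes ^ n * p - g) + g * (slopes ^ m * q - h)
      = slopes ^ (n + m) * (p * q) - g * h"
    by (simp add: power_add algebra_simps)
  finally show ?case
    using * by (intro exI[of _ "n + m"] exI[of _ "g * h"] conjI middle_polys_intros)
qed

text \<open>
  The generic point of the level set: the outer coordinates are the solutions of the two linear equations
  over the field of fractions.
\<close>

definition generic_point :: "6 \<Rightarrow> 'a poly6 fract" where
  "generic_point i =
     (if i = 1 then to_fract (2 * Const \<alpha> - rest1) / to_fract slope1
      else if i = 6 then to_fract (6 * Const \<beta> - rest2) / to_fract slope2
      else to_fract (Var i))"

lemma eval_generic_middle_polys: "g \<in> middle_polys \<Longrightarrow> eval_fract generic_point g = to_fract g"
  by (rule eval_fract_middle_polys) (auto simp: generic_point_def)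

lemma eval_generic_slopes_nonzero: "eval_fract generic_point slopes \<noteq> 0"
  by (simp add: slope1_nonzero slope2_nonzero eval_generic_middle_polys middle_polys_slopes middle_polys.mult)

lemma level_ideal_subset_kernel: "level_ideal \<subseteq> {f. eval_fract generic_point f = 0}"
proof (rule level_ideal_minimal[OF is_ideal_kernel])
  let ?ev = "eval_fract generic_point"
  have "?ev (2 * (Omega1 - Const \<alpha>)) = ?ev (Var 1 * slope1 - (2 * Const \<alpha> - rest1))"
    by (simp only: right_diff_distrib Omega1_linear) (simp add: algebra_simps)
  also have "\<dots> = 0"
    unfolding eval_fract_diff[of _ "_ * _"] eval_fract_mult[of _ "Var 1"]
    by (simp add: slope1_nonzero eval_generic_middle_polys middle_polys_slopes middle_polys_intros generic_point_def)
  finally have "?ev 2 * ?ev (Omega1 - Const \<alpha>) = 0" unfolding eval_fract_mult .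
  then show "Omega1 - Const \<alpha> \<in> {f. ?ev f = 0}" by simp
  have "?ev (6 * (Omega2 - Const \<beta>)) = ?ev (Var 6 * slope2 - (6 * Const \<beta> - rest2))"
    by (simp only: right_diff_distrib Omega2_linear) (simp add: algebra_simps)
  also have "\<dots> = 0"
    unfolding eval_fract_diff[of _ "_ * _"] eval_fract_mult[of _ "Var 6"]
    by (simp add: slope2_nonzero eval_generic_middle_polys middle_polys_slopes middle_polys_intros generic_point_def)
  finally have "?ev 6 * ?ev (Omega2 - Const \<beta>) = 0" unfolding eval_fract_mult .
  then show "Omega2 - Const \<beta> \<in> {f. ?ev f = 0}" by simp
qed

text \<open>
  A polynomial that vanishes at the generic point reduces, after multiplication by a power of the slopes, to a
  middle polynomial that vanishes there; such a middle polynomial is zero.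
\<close>

lemma kernel_eq_saturation:
  "{f. eval_fract generic_point f = 0} = saturation slopes level_ideal"
proof (intro equalityI subsetI)
  fix f assume f: "f \<in> {f. eval_fract generic_point f = 0}"
  obtain n g where g: "g \<in> middle_polys" and n: "slopes ^ n * f - g \<in> level_ideal"
    using level_ideal_pseudo_reduction by blast
  have "eval_fract generic_point (slopes ^ n * f - g) = 0"
    using n level_ideal_subset_kernel by blast
  then have "to_fract g = 0"
    using f by (simp add: eval_fract_diff eval_fract_mult[of _ _ f] eval_generic_middle_polys[OF g])
  with n show "f \<in> saturation slopes level_ideal"
    by (auto simp: saturation_def)
next
  fix f assume "f \<in> saturation slopes level_ideal"
  then obtain n where "slopes ^ n * f \<in> level_ideal" by (auto simp: saturation_def)
  then have "eval_fract generic_point (slopes ^ n * f) = 0"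
    using level_ideal_subset_kernel by blast
  then show "f \<in> {f. eval_fract generic_point f = 0}"
    using eval_generic_slopes_nonzero
    by (simp add: eval_fract_mult[of _ _ f] eval_fract_power)
qed

text \<open>
  The radical \<open>R\<close> of \<open>J\<close> contains \<open>slope1 slope2\<close>. If \<open>\<alpha> \<noteq> 0\<close>, the bracket with \<open>X\<^sub>1\<close> gives
  \<open>rest1 slope2 \<in> R\<close>, hence \<open>\<Omega>\<^sub>1 slope2 \<in> R\<close> and \<open>slope2 \<in> R\<close>; the bracket with \<open>X\<^sub>6\<close> then gives
  \<open>rest2 \<in> R\<close>, the cube relation gives \<open>slope1 \<in> R\<close>, so \<open>rest1\<close> and finally \<open>\<Omega>\<^sub>1\<close> lie in \<open>R\<close>,
  against \<open>\<Omega>\<^sub>1 = \<alpha>\<close>. If \<open>\<beta> \<noteq> 0\<close>, the bracket with \<open>X\<^sub>6\<close> gives \<open>slope1 rest2 \<in> R\<close>, hence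
  \<open>\<Omega>\<^sub>2 slope1 \<in> R\<close> and \<open>slope1 \<in> R\<close>; then \<open>rest1\<close>, \<open>slope2\<close>, \<open>rest2\<close> and \<open>\<Omega>\<^sub>2\<close> follow, against
  \<open>\<Omega>\<^sub>2 = \<beta>\<close>.
\<close>

lemma degeneracy_locus_empty:
  assumes nonzero: "(\<alpha>, \<beta>) \<noteq> (0, 0)"
    and J: "poisson_ideal J" "level_ideal \<subseteq> J" and n: "slopes ^ n \<in> J"
  shows "1 \<in> J"
proof -
  let ?R = "radical_of J"
  note R = poisson_ideal_radical[OF J(1)]
  note ideal = poisson_idealD(1)[OF R]
  note closed = is_ideal_zero[OF ideal] is_ideal_add[OF ideal] is_ideal_diff[OF ideal]
    is_ideal_uminus[OF ideal] is_ideal_mult_left[OF ideal]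
    poisson_idealD(2)[OF R]
  note cancel = ideal_cancel_numeral[OF ideal]
  have gens: "Omega1 - Const \<alpha> \<in> ?R" "Omega2 - Const \<beta> \<in> ?R"
    using level_ideal_generators J(2) radical_superset by blast+
  have slopes: "slopes \<in> ?R" using n by (auto simp: radical_of_def)
  have one: "1 \<in> ?R" if "Const c \<in> ?R" "c \<noteq> 0" for c
    using ideal_Const_imp_one[OF ideal] that by blast
  have rest1: "rest1 \<in> ?R" if "slope1 \<in> ?R"
  proof -
    \<comment> \<open>Here and below, known members precede the closure rules, so that a product that is known to
      lie in the radical is not split into its factors.\<close>
    have "2 * rest1 = - pbracket (Var 1) slope1" by (simp add: pbracket_slopes)
    also have "\<dots> \<in> ?R" by (rule that closed)+
    finally show ?thesis by (rule cancel)
  qed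
  have "1 \<in> ?R"
  proof (cases "\<alpha> = 0")
    case False
    have "2 * (rest1 * slope2) = 3 * Var 1 * slopes - pbracket (Var 1) slopes"
      by (simp add: pbracket_mult_right pbracket_slopes algebra_simps)
    also have "\<dots> \<in> ?R" by (rule slopes closed)+
    finally have rest1_slope2: "rest1 * slope2 \<in> ?R" by (rule cancel)
    have "Var 1 * slopes + rest1 * slope2 - slope2 * (2 * (Omega1 - Const \<alpha>)) \<in> ?R"
      by (rule slopes rest1_slope2 gens closed)+
    also have "Var 1 * slopes + rest1 * slope2 - slope2 * (2 * (Omega1 - Const \<alpha>))
        = 2 * (Const \<alpha> * slope2)"
      by (simp only: right_diff_distrib Omega1_linear) (simp add: algebra_simps)
    finally have "Const \<alpha> * slope2 \<in> ?R" by (rule cancel)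
    then have slope2: "slope2 \<in> ?R" by (rule ideal_cancel_Const[OF ideal False])
    have "6 * rest2 = pbracket (Var 6) slope2" by (simp add: pbracket_slopes)
    also have "\<dots> \<in> ?R" by (rule slope2 closed)+
    finally have rest2: "rest2 \<in> ?R" by (rule cancel)
    have "slope1 ^ 3 = - 2 * Var 5 ^ 3 * slope2 - 3 * Var 4 * rest2"
      using slope_relations(1) by (simp add: eq_diff_eq mult_ac add.commute)
    also have "\<dots> \<in> ?R" by (rule slope2 rest2 closed)+
    finally have slope1: "slope1 \<in> ?R" by (rule radical_power_imp)
    have "2 * Const \<alpha> = Var 1 * slope1 + rest1 - 2 * (Omega1 - Const \<alpha>)"
      by (simp only: right_diff_distrib Omega1_linear) (simp add: algebra_simps)
    also have "\<dots> \<in> ?R" by (rule slope1 rest1[OF slope1] gens closed)+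
    finally have "Const \<alpha> \<in> ?R" by (rule cancel)
    then show ?thesis using False by (rule one)
  next
    case True
    with nonzero have \<beta>: "\<beta> \<noteq> 0" by simp
    have "6 * (slope1 * rest2) ^ 2
        = rest2 * (slope1 * pbracket (Var 6) slopes - pbracket (Var 6) slope1 * slopes)"
      by (simp add: pbracket_mult_right pbracket_slopes algebra_simps power2_eq_square)
    also have "\<dots> \<in> ?R" by (rule slopes closed)+
    finally have "(slope1 * rest2) ^ 2 \<in> ?R" by (rule cancel)
    then have slope1_rest2: "slope1 * rest2 \<in> ?R" by (rule radical_power_imp)
    have "Var 6 * slopes + slope1 * rest2 - slope1 * (6 * (Omega2 - Const \<beta>)) \<in> ?R"
      by (rule slopes slope1_rest2 gens closed)+
    also have "Var 6 * slopes + slope1 * rest2 - slope1 * (6 * (Omega2 - Const \<beta>))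
        = 6 * (Const \<beta> * slope1)"
      by (simp only: right_diff_distrib Omega2_linear) (simp add: algebra_simps)
    finally have "Const \<beta> * slope1 \<in> ?R" by (rule cancel)
    then have slope1: "slope1 \<in> ?R" by (rule ideal_cancel_Const[OF ideal \<beta>])
    have slope2: "slope2 \<in> ?R"
      unfolding slope_relations(2) by (rule slope1 rest1[OF slope1] closed)+
    have rest2: "rest2 \<in> ?R"
      unfolding slope_relations(3) power2_eq_square[of slope1]
      by (rule slope1 rest1[OF slope1] closed)+
    have "6 * Const \<beta> = Var 6 * slope2 + rest2 - 6 * (Omega2 - Const \<beta>)"
      by (simp only: right_diff_distrib Omega2_linear) (simp add: algebra_simps)
    also have "\<dots> \<in> ?R" by (rule slope2 rest2 gens closed)+
    finally have "Const \<beta> \<in> ?R" by (rule cancel)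
    then show ?thesis using \<beta> by (rule one)
  qed
  then show ?thesis by (simp add: radical_of_def)
qed

text \<open>
  The kernel consists of elements that a power of the slopes carries into the ideal. Since it is finitely
  generated, one power serves all of them, and that power lies in the set of multipliers that carry the kernel
  into the ideal. These multipliers form a Poisson ideal, because kernel and ideal are Poisson.
\<close>

lemma kernel_eq_level_ideal:
  assumes nonzero: "(\<alpha>, \<beta>) \<noteq> (0, 0)"
  shows "{f. eval_fract generic_point f = 0} = level_ideal"
proof
  let ?K = "saturation slopes level_ideal"
  note P = is_ideal_level_ideal
  note K = poisson_ideal_saturation[OF poisson_ideal_level_ideal, of slopes]
  from hilbert_basis[OF poisson_idealD(1)[OF K]] obtain F where F: "finite F" "F \<subseteq> ?K"
    and generates: "\<forall>J. is_ideal J \<longrightarrow> F \<subseteq> J \<longrightarrow> ?K \<subseteq> J"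
    by (elim exE conjE) (rule that)
  have "\<forall>f\<in>F. \<exists>n. slopes ^ n * f \<in> level_ideal"
    using F(2) by (auto simp: saturation_def)
  then obtain e where e: "\<And>f. f \<in> F \<Longrightarrow> slopes ^ e f * f \<in> level_ideal"
    using bchoice[of F "\<lambda>f n. slopes ^ n * f \<in> level_ideal"] by auto
  define N where "N = (\<Sum>f\<in>F. e f)"
  have "F \<subseteq> {f. slopes ^ N * f \<in> level_ideal}"
    using power_mult_mono_ideal[OF P e] member_le_sum[of _ F e] F(1) by (auto simp: N_def)
  moreover have "is_ideal {f. slopes ^ N * f \<in> level_ideal}"
    unfolding ideal_of_type_iff
    by (auto simp: distrib_left mult.left_commute[of "slopes ^ N"]
        intro: is_ideal_zero[OF P] is_ideal_add[OF P] is_ideal_mult_left[OF P])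
  ultimately have N: "slopes ^ N * f \<in> level_ideal" if "f \<in> ?K" for f
    using generates that by blast
  define A where "A = {c. \<forall>f\<in>?K. c * f \<in> level_ideal}"
  have "poisson_ideal A"
    unfolding poisson_ideal_def
  proof (intro conjI allI ballI)
    show "is_ideal A"
      unfolding ideal_of_type_iff A_def
      by (auto simp: distrib_right mult.assoc
          intro: is_ideal_zero[OF P] is_ideal_add[OF P] is_ideal_mult_left[OF P])
    fix x c assume c: "c \<in> A"
    have "pbracket x c * f \<in> level_ideal" if f: "f \<in> ?K" for f
    proof -
      have "pbracket x (c * f) - c * pbracket x f \<in> level_ideal"
        using c f poisson_idealD(2)[OF K f]
        by (intro is_ideal_diff[OF P] poisson_idealD(2)[OF poisson_ideal_level_ideal])
           (auto simp: A_def)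
      then show ?thesis by (simp add: pbracket_mult_right)
    qed
    then show "pbracket x c \<in> A" by (simp add: A_def)
  qed
  moreover have "level_ideal \<subseteq> A" by (auto simp: A_def is_ideal_mult_right[OF P])
  moreover have "slopes ^ N \<in> A" using N by (simp add: A_def)
  ultimately have "1 \<in> A" by (rule degeneracy_locus_empty[OF nonzero])
  then show "{f. eval_fract generic_point f = 0} \<subseteq> level_ideal"
    by (auto simp: kernel_eq_saturation A_def)
qed (rule level_ideal_subset_kernel)

section \<open>Primality and maximality\<close>

lemma level_ideal_proper: "1 \<notin> level_ideal"
  using level_ideal_subset_kernel by auto

lemma primeideal_level_ideal:
  assumes nonzero: "(\<alpha>, \<beta>) \<noteq> (0, 0)"
  shows "primeideal level_ideal poly6_ring"
proof (rule primeidealI[OF is_ideal_level_ideal])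
  show "cring (poly6_ring :: 'a poly6 ring)" by (rule cring_from_type_algebra)
  show "carrier poly6_ring \<noteq> level_ideal"
    using level_ideal_proper by (auto simp: ring_of_type_algebra_def)
  fix a b
  assume "a \<otimes>\<^bsub>poly6_ring\<^esub> b \<in> level_ideal"
  then have "eval_fract generic_point (a * b) = 0"
    using level_ideal_subset_kernel by (auto simp: ring_of_type_algebra_def)
  then show "a \<in> level_ideal \<or> b \<in> level_ideal"
    using kernel_eq_level_ideal[OF nonzero] by (auto simp: eval_fract_mult)
qed

lemma maximal_level_ideal:
  assumes nonzero: "(\<alpha>, \<beta>) \<noteq> (0, 0)"
  shows "maximal_poisson_ideal level_ideal"
proof -
  have "J = level_ideal" if J: "poisson_ideal J" "J \<noteq> UNIV" "level_ideal \<subseteq> J" for J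
  proof (rule ccontr)
    assume "J \<noteq> level_ideal"
    with J(3) obtain f where f: "f \<in> J" "f \<notin> level_ideal" by blast
    note ideal = poisson_idealD(1)[OF J(1)]
    obtain n g where g: "g \<in> middle_polys" and n: "slopes ^ n * f - g \<in> level_ideal"
      using level_ideal_pseudo_reduction by blast
    have "slopes ^ n * f - (slopes ^ n * f - g) \<in> J"
      by (rule is_ideal_diff[OF ideal is_ideal_mult_left[OF ideal f(1)] subsetD[OF J(3) n]])
    then have "g \<in> J" by simp
    moreover have "g \<noteq> 0"
    proof
      assume "g = 0"
      with n have "f \<in> saturation slopes level_ideal" by (auto simp: saturation_def)
      with f(2) show False
        unfolding kernel_eq_saturation[symmetric] kernel_eq_level_ideal[OF nonzero] by simp
    qed
    ultimately obtain m where "slopes ^ m \<in> J"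
      using slopes_power_in_poisson_ideal[OF J(1)] g by blast
    then have "1 \<in> J" by (rule degeneracy_locus_empty[OF nonzero J(1,3)])
    with J(2) show False using ideal_eq_UNIV_iff[OF ideal] by blast
  qed
  then show ?thesis
    unfolding maximal_poisson_ideal_def
    using poisson_ideal_level_ideal level_ideal_proper by auto
qed

end

theorem proposition4p12:
  fixes \<alpha> \<beta> :: "'a::field_char_0"
  assumes "(\<alpha>, \<beta>) \<noteq> (0, 0)"
  shows "poisson_prime_ideal (genideal poly6_ring {Omega1 - Const \<alpha>, Omega2 - Const \<beta>}) \<and>
         maximal_poisson_ideal (genideal poly6_ring {Omega1 - Const \<alpha>, Omega2 - Const \<beta>})"
  using primeideal_level_ideal[OF assms] maximal_level_ideal[OF assms]
    poisson_ideal_level_ideal[of \<alpha> \<beta>]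
  unfolding level_ideal_def poisson_prime_ideal_def by blast

end
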